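(* Let $\mathbb{X}$ be a compact Hausdorff space. Then there is a homeomorphism $$\mathsf{pt}(\mathsf{M}(\mathsf{opn}\,\mathbb{X})) \cong \mathsf{D}_{\mathbf{kh}}\mathbb{X}.$$
   Context: A frame is a complete lattice in which $a \wedge \bigvee S = \bigvee\{a \wedge s \mid s \in S\}$ for all elements $a$ and subsets $S$; frame homomorphisms preserve finite meets and arbitrary joins. For a topological space $\mathbb{X}$, $\Omega\mathbb{X}$ is its set of open subsets and $\mathsf{opn}\,\mathbb{X}$ is this set viewed as a frame. For a frame $F$, $\mathsf{pt}F$ is the set of frame homomorphisms $p : F \to 2$, where $2 = \{\top,\bot\}$ is the two-element frame, topologised by the open sets $\tilde a = \{p \in \mathsf{pt}F \mid p(a) = \top\}$, $a \in F$. A directed set is a nonempty set in which any two elements have an upper bound in the set; $\bigvee^{\uparrow}$ denotes a join of a directed set. The frame $\mathsf{M}F$: for a frame $F$, $\mathsf{M}F$ is the frame presented by generators $\Box a, \Diamond a$ ($a \in F$) subject to the relations ($M_1$) $\Box(a \wedge b) \leq \Box a$; ($M_2$) $\Box a \wedge \Diamond b = \bot$ whenever $a \wedge b = \bot$; ($M_3$) $\Box \bigvee^{\uparrow} A = \bigvee^{\uparrow}\{\Box a \mid a \in A\}$; ($M_4$) $\Diamond a \leq \Diamond(a \vee b)$; ($M_5$) $\Box a \vee \Diamond b = \top$ whenever $a \vee b = \top$; ($M_6$) $\Diamond \bigvee^{\uparrow} A = \bigvee^{\uparrow}\{\Diamond a \mid a \in A\}$; for all $a, b \in F$ and all directed $A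 \subseteq F$. The space $\mathsf{D}_{\mathbf{kh}}\mathbb{X}$: for a compact Hausdorff space $\mathbb{X}$ with underlying set $X$, the points of $\mathsf{D}_{\mathbf{kh}}\mathbb{X}$ are the collections $W$ of subsets of $X$ such that for all $u \subseteq X$: $u \in W$ iff there exists a closed set $c \subseteq u$ such that every open superset of $c$ is in $W$. The topology of $\mathsf{D}_{\mathbf{kh}}\mathbb{X}$ is generated by the subbase of all sets $\{W \in \mathsf{D}_{\mathbf{kh}}\mathbb{X} \mid a \in W\}$ and $\{W \in \mathsf{D}_{\mathbf{kh}}\mathbb{X} \mid X \setminus a \notin W\}$, where $a$ ranges over $\Omega\mathbb{X}$. *)

theory Defs
  imports "HOL-Algebra.Complete_Lattice" "HOL-Analysis.T1_Spaces"
begin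

section \<open>Frames and frame homomorphisms\<close>

locale frame = complete_lattice L for L (structure) +
  assumes meet_sup_distrib:
    "\<lbrakk>a \<in> carrier L; S \<subseteq> carrier L\<rbrakk> \<Longrightarrow> a \<sqinter> \<Squnion>S = \<Squnion>((\<lambda>s. a \<sqinter> s) ` S)"

definition frame_hom :: "('a, 'c) gorder_scheme \<Rightarrow> ('b, 'd) gorder_scheme \<Rightarrow> ('a \<Rightarrow> 'b) \<Rightarrow> bool"
  where "frame_hom F K h \<longleftrightarrow>
    h \<in> carrier F \<rightarrow> carrier K \<and>
    h \<top>\<^bsub>F\<^esub> = \<top>\<^bsub>K\<^esub> \<and>
    (\<forall>a\<in>carrier F. \<forall>b\<in>carrier F. h (a \<sqinter>\<^bsub>F\<^esub> b) = h a \<sqinter>\<^bsub>K\<^esub> h b) \<and>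
    (\<forall>S. S \<subseteq> carrier F \<longrightarrow> h (\<Squnion>\<^bsub>F\<^esub> S) = \<Squnion>\<^bsub>K\<^esub> (h ` S))"

definition directed_in :: "('a, 'c) gorder_scheme \<Rightarrow> 'a set \<Rightarrow> bool"
  where "directed_in F A \<longleftrightarrow> A \<subseteq> carrier F \<and> A \<noteq> {} \<and>
    (\<forall>x\<in>A. \<forall>y\<in>A. \<exists>z\<in>A. x \<sqsubseteq>\<^bsub>F\<^esub> z \<and> y \<sqsubseteq>\<^bsub>F\<^esub> z)"

definition set_order :: "'a set set \<Rightarrow> 'a set gorder"
  where "set_order C = \<lparr>carrier = C, eq = (=), le = (\<subseteq>)\<rparr>"

definition opn :: "'a topology \<Rightarrow> 'a set gorder"
  where "opn X = set_order {U. openin X U}"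

definition two :: "bool gorder"
  where "two = \<lparr>carrier = UNIV, eq = (=), le = (\<longrightarrow>)\<rparr>"


section \<open>Points of a frame\<close>

text \<open>Homomorphisms are functions on the carrier only, so they are taken to be extensional; an
  equation \<open>p a = \<top>\<close> in the two-element frame is written \<open>p a\<close>.\<close>

definition points :: "('a, 'c) gorder_scheme \<Rightarrow> ('a \<Rightarrow> bool) set"
  where "points F = {p \<in> extensional (carrier F). frame_hom F two p}"

text \<open>The sets below already form a topology when \<open>F\<close> is a frame; see
  \<open>openin_pt\<close> below.\<close>

definition pt :: "('a, 'c) gorder_scheme \<Rightarrow> ('a \<Rightarrow> bool) topology"
  where "pt F = topology (\<lambda>U. \<exists>a\<in>carrier F. U = {p \<in> points F. p a})"


section \<open>Presentation of frames by generators and relations\<close>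

text \<open>The free frame on a set \<open>G\<close>: a finite subset of \<open>G\<close> stands for the formal meet of its elements,
  and a set of finite subsets, closed under passing to larger finite subsets (that is, to smaller
  formal meets), stands for the join of these meets.\<close>

definition free_frame :: "'g set \<Rightarrow> 'g set set gorder"
  where "free_frame G = set_order {D. D \<subseteq> Fpow G \<and> (\<forall>A\<in>D. \<forall>B\<in>Fpow G. A \<subseteq> B \<longrightarrow> B \<in> D)}"

definition free_gen :: "'g set \<Rightarrow> 'g \<Rightarrow> 'g set set"
  where "free_gen G g = {A \<in> Fpow G. g \<in> A}"

definition frame_congruence :: "('a, 'c) gorder_scheme \<Rightarrow> ('a \<times> 'a) set \<Rightarrow> bool"
  where "frame_congruence F \<theta> \<longleftrightarrow>
    equiv (carrier F) \<theta> \<and>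
    (\<forall>(a, a')\<in>\<theta>. \<forall>(b, b')\<in>\<theta>. (a \<sqinter>\<^bsub>F\<^esub> b, a' \<sqinter>\<^bsub>F\<^esub> b') \<in> \<theta>) \<and>
    (\<forall>P. P \<subseteq> \<theta> \<longrightarrow> (\<Squnion>\<^bsub>F\<^esub> (fst ` P), \<Squnion>\<^bsub>F\<^esub> (snd ` P)) \<in> \<theta>)"

definition generated_congruence :: "('a, 'c) gorder_scheme \<Rightarrow> ('a \<times> 'a) set \<Rightarrow> ('a \<times> 'a) set"
  where "generated_congruence F R = \<Inter>{\<theta>. frame_congruence F \<theta> \<and> R \<subseteq> \<theta>}"

definition quotient_frame :: "('a, 'c) gorder_scheme \<Rightarrow> ('a \<times> 'a) set \<Rightarrow> 'a set gorder"
  where "quotient_frame F \<theta> =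
    \<lparr>carrier = carrier F // \<theta>, eq = (=), le = (\<lambda>A B. \<exists>a\<in>A. \<exists>b\<in>B. a \<sqsubseteq>\<^bsub>F\<^esub> b)\<rparr>"

text \<open>The elements of \<open>R\<close> are pairs of elements of \<open>free_frame G\<close>, and a pair \<open>(u, v)\<close> stands for
  the relation \<open>u = v\<close>. The universal property is \<open>presented_frame_universal\<close> below.\<close>

definition presented_frame :: "'g set \<Rightarrow> ('g set set \<times> 'g set set) set \<Rightarrow> 'g set set set gorder"
  where "presented_frame G R = quotient_frame (free_frame G) (generated_congruence (free_frame G) R)"

definition presented_gen :: "'g set \<Rightarrow> ('g set set \<times> 'g set set) set \<Rightarrow> 'g \<Rightarrow> 'g set set set"
  where "presented_gen G R g = generated_congruence (free_frame G) R `` {free_gen G g}"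


section \<open>The frame \<open>M F\<close>\<close>

datatype 'a modal = Box 'a | Dia 'a

definition M_gens :: "('a, 'c) gorder_scheme \<Rightarrow> 'a modal set"
  where "M_gens F = Box ` carrier F \<union> Dia ` carrier F"

text \<open>An inequality \<open>u \<le> v\<close> is expressed as the equation \<open>u \<sqinter> v = u\<close>.\<close>

definition M_rels :: "('a, 'c) gorder_scheme \<Rightarrow> ('a modal set set \<times> 'a modal set set) set"
  where "M_rels F =
    (let L = free_frame (M_gens F);
         box = (\<lambda>a. free_gen (M_gens F) (Box a));
         dia = (\<lambda>a. free_gen (M_gens F) (Dia a));
         leq = (\<lambda>u v. (u \<sqinter>\<^bsub>L\<^esub> v, u))
     in {leq (box (a \<sqinter>\<^bsub>F\<^esub> b)) (box a) | a b. a \<in> carrier F \<and> b \<in> carrier F}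
      \<union> {(box a \<sqinter>\<^bsub>L\<^esub> dia b, \<bottom>\<^bsub>L\<^esub>) | a b.
           a \<in> carrier F \<and> b \<in> carrier F \<and> a \<sqinter>\<^bsub>F\<^esub> b = \<bottom>\<^bsub>F\<^esub>}
      \<union> {(box (\<Squnion>\<^bsub>F\<^esub> A), \<Squnion>\<^bsub>L\<^esub> (box ` A)) | A. directed_in F A}
      \<union> {leq (dia a) (dia (a \<squnion>\<^bsub>F\<^esub> b)) | a b. a \<in> carrier F \<and> b \<in> carrier F}
      \<union> {(box a \<squnion>\<^bsub>L\<^esub> dia b, \<top>\<^bsub>L\<^esub>) | a b.
           a \<in> carrier F \<and> b \<in> carrier F \<and> a \<squnion>\<^bsub>F\<^esub> b = \<top>\<^bsub>F\<^esub>}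
      \<union> {(dia (\<Squnion>\<^bsub>F\<^esub> A), \<Squnion>\<^bsub>L\<^esub> (dia ` A)) | A. directed_in F A})"

definition M_frame :: "('a, 'c) gorder_scheme \<Rightarrow> 'a modal set set set gorder"
  where "M_frame F = presented_frame (M_gens F) (M_rels F)"


section \<open>The space \<open>D_kh X\<close>\<close>

definition D_kh_points :: "'a topology \<Rightarrow> 'a set set set"
  where "D_kh_points X = {W. W \<subseteq> Pow (topspace X) \<and>
    (\<forall>u. u \<subseteq> topspace X \<longrightarrow>
      (u \<in> W \<longleftrightarrow> (\<exists>c. closedin X c \<and> c \<subseteq> u \<and> (\<forall>a. openin X a \<and> c \<subseteq> a \<longrightarrow> a \<in> W))))}"

definition D_kh :: "'a topology \<Rightarrow> 'a set set topology"
  where "D_kh X = topology_generated_by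
    ({{W \<in> D_kh_points X. a \<in> W} | a. openin X a} \<union>
     {{W \<in> D_kh_points X. topspace X - a \<notin> W} | a. openin X a})"

lemma topspace_D_kh: "topspace (D_kh X) = D_kh_points X"
proof -
  have "{W \<in> D_kh_points X. topspace X \<in> W} \<union> {W \<in> D_kh_points X. topspace X - {} \<notin> W}
      \<subseteq> topspace (D_kh X)"
    unfolding D_kh_def topology_generated_by_topspace
    using openin_empty[of X] openin_topspace[of X] by blast
  moreover have "topspace (D_kh X) \<subseteq> D_kh_points X"
    unfolding D_kh_def topology_generated_by_topspace by blast
  ultimately show ?thesis by auto
qed


section \<open>Well-definedness of the constructions\<close>

lemma Upper_eq: "A \<subseteq> carrier L \<Longrightarrow> Upper L A = {u \<in> carrier L. \<forall>x\<in>A. x \<sqsubseteq>\<^bsub>L\<^esub> u}"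
  by (auto simp: Upper_def)

lemma Lower_eq: "A \<subseteq> carrier L \<Longrightarrow> Lower L A = {l \<in> carrier L. \<forall>x\<in>A. l \<sqsubseteq>\<^bsub>L\<^esub> x}"
  by (auto simp: Lower_def)

lemma (in partial_order) sup_eqI:
  assumes "A \<subseteq> carrier L" "s \<in> carrier L" "\<And>x. x \<in> A \<Longrightarrow> x \<sqsubseteq> s"
    "\<And>y. y \<in> carrier L \<Longrightarrow> (\<And>x. x \<in> A \<Longrightarrow> x \<sqsubseteq> y) \<Longrightarrow> s \<sqsubseteq> y"
  shows "\<Squnion>A = s"
proof -
  have "least L s (Upper L A)"
    using assms(2-) by (simp add: least_def Upper_eq[OF assms(1)])
  then show ?thesis
    unfolding sup_def by (metis least_unique someI)
qed

lemma (in partial_order) inf_eqI: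
  assumes "A \<subseteq> carrier L" "s \<in> carrier L" "\<And>x. x \<in> A \<Longrightarrow> s \<sqsubseteq> x"
    "\<And>y. y \<in> carrier L \<Longrightarrow> (\<And>x. x \<in> A \<Longrightarrow> y \<sqsubseteq> x) \<Longrightarrow> y \<sqsubseteq> s"
  shows "\<Sqinter>A = s"
proof -
  have "greatest L s (Lower L A)"
    using assms(2-) by (simp add: greatest_def Lower_eq[OF assms(1)])
  then show ?thesis
    unfolding inf_def by (metis greatest_unique someI)
qed

lemma (in partial_order) meet_eqI:
  assumes "a \<in> carrier L" "b \<in> carrier L" "s \<in> carrier L" "s \<sqsubseteq> a" "s \<sqsubseteq> b"
    "\<And>y. y \<in> carrier L \<Longrightarrow> y \<sqsubseteq> a \<Longrightarrow> y \<sqsubseteq> b \<Longrightarrow> y \<sqsubseteq> s"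
  shows "a \<sqinter> b = s"
  unfolding meet_def using assms by (intro inf_eqI) auto

lemma (in partial_order) top_eqI:
  assumes "t \<in> carrier L" "\<And>y. y \<in> carrier L \<Longrightarrow> y \<sqsubseteq> t"
  shows "\<top> = t"
proof -
  have "greatest L t (carrier L)" using assms by (auto simp: greatest_def)
  then show ?thesis
    unfolding top_def by (metis greatest_unique someI)
qed

lemma (in partial_order) complete_lattice_from_sups:
  assumes "\<And>A. A \<subseteq> carrier L \<Longrightarrow> \<exists>s\<in>carrier L. (\<forall>x\<in>A. x \<sqsubseteq> s) \<and>
    (\<forall>y\<in>carrier L. (\<forall>x\<in>A. x \<sqsubseteq> y) \<longrightarrow> s \<sqsubseteq> y)"
  shows "complete_lattice L"
proof (rule complete_latticeI)
  fix A assume A: "A \<subseteq> carrier L"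
  obtain s where s: "s \<in> carrier L" "\<forall>x\<in>A. x \<sqsubseteq> s"
      "\<forall>y\<in>carrier L. (\<forall>x\<in>A. x \<sqsubseteq> y) \<longrightarrow> s \<sqsubseteq> y"
    using assms[OF A] by blast
  then have "least L s (Upper L A)"
    by (simp add: least_def Upper_eq[OF A])
  then show "\<exists>s. least L s (Upper L A)" ..
  define B where "B = {y \<in> carrier L. \<forall>x\<in>A. y \<sqsubseteq> x}"
  have "B \<subseteq> carrier L" by (auto simp: B_def)
  then obtain i where i: "i \<in> carrier L" "\<forall>x\<in>B. x \<sqsubseteq> i"
      "\<forall>y\<in>carrier L. (\<forall>x\<in>B. x \<sqsubseteq> y) \<longrightarrow> i \<sqsubseteq> y"
    using assms by blast
  have "greatest L i (Lower L A)"
  proof (rule greatest_LowerI)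
    show "i \<sqsubseteq> x" if "x \<in> A" for x
      using that A i(3) by (auto simp: B_def)
    show "y \<sqsubseteq> i" if "y \<in> Lower L A" for y
      using that i(2) by (simp add: B_def Lower_eq[OF A])
  qed (use A i in auto)
  then show "\<exists>i. greatest L i (Lower L A)" ..
qed

locale set_frame =
  fixes C :: "'a set set"
  assumes Union_closed: "S \<subseteq> C \<Longrightarrow> \<Union>S \<in> C"
    and Int_closed: "a \<in> C \<Longrightarrow> b \<in> C \<Longrightarrow> a \<inter> b \<in> C"
begin

sublocale po: partial_order "set_order C"
  by unfold_locales (auto simp: set_order_def)

lemma sup_eq: "S \<subseteq> C \<Longrightarrow> \<Squnion>\<^bsub>set_order C\<^esub> S = \<Union>S"
  by (rule po.sup_eqI) (auto simp: set_order_def intro: Union_closed)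

lemma join_eq: "a \<in> C \<Longrightarrow> b \<in> C \<Longrightarrow> a \<squnion>\<^bsub>set_order C\<^esub> b = a \<union> b"
  by (simp add: join_def sup_eq)

lemma meet_eq: "a \<in> C \<Longrightarrow> b \<in> C \<Longrightarrow> a \<sqinter>\<^bsub>set_order C\<^esub> b = a \<inter> b"
  by (rule po.meet_eqI) (auto simp: set_order_def intro: Int_closed)

lemma top_eq: "\<top>\<^bsub>set_order C\<^esub> = \<Union>C"
  by (rule po.top_eqI) (auto simp: set_order_def intro: Union_closed)

lemma frame: "frame (set_order C)"
proof -
  interpret complete_lattice "set_order C"
  proof (rule po.complete_lattice_from_sups)
    fix A assume "A \<subseteq> carrier (set_order C)"
    then show "\<exists>s\<in>carrier (set_order C). (\<forall>x\<in>A. x \<sqsubseteq>\<^bsub>set_order C\<^esub> s) \<and>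
      (\<forall>y\<in>carrier (set_order C). (\<forall>x\<in>A. x \<sqsubseteq>\<^bsub>set_order C\<^esub> y) \<longrightarrow> s \<sqsubseteq>\<^bsub>set_order C\<^esub> y)"
      by (intro bexI[of _ "\<Union>A"]) (auto simp: set_order_def intro: Union_closed)
  qed
  show ?thesis
  proof
    fix a S assume a: "a \<in> carrier (set_order C)" and S: "S \<subseteq> carrier (set_order C)"
    then have "a \<in> C" "S \<subseteq> C" by (auto simp: set_order_def)
    then have 1: "(\<lambda>s. a \<sqinter>\<^bsub>set_order C\<^esub> s) ` S = (\<lambda>s. a \<inter> s) ` S"
      and 2: "(\<lambda>s. a \<inter> s) ` S \<subseteq> C"
      by (auto simp: meet_eq subset_iff intro: Int_closed)
    show "a \<sqinter>\<^bsub>set_order C\<^esub> \<Squnion>\<^bsub>set_order C\<^esub> S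
        = \<Squnion>\<^bsub>set_order C\<^esub> ((\<lambda>s. a \<sqinter>\<^bsub>set_order C\<^esub> s) ` S)"
      unfolding 1 using \<open>a \<in> C\<close> \<open>S \<subseteq> C\<close> 2 by (simp add: sup_eq meet_eq Union_closed)
  qed
qed

end

lemma set_frame_opn: "set_frame {U. openin X U}"
  by unfold_locales auto

lemma frame_opn: "frame (opn X)"
  unfolding opn_def by (rule set_frame.frame[OF set_frame_opn])

lemma set_frame_free: "set_frame {D. D \<subseteq> Fpow G \<and> (\<forall>A\<in>D. \<forall>B\<in>Fpow G. A \<subseteq> B \<longrightarrow> B \<in> D)}"
  by unfold_locales blast+

lemma frame_free_frame: "frame (free_frame G)"
  unfolding free_frame_def by (rule set_frame.frame[OF set_frame_free])

lemma partial_order_two: "partial_order two"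
  by unfold_locales (auto simp: two_def)

lemma two_simps:
  "carrier two = UNIV" "\<Squnion>\<^bsub>two\<^esub> S = (True \<in> S)" "a \<sqinter>\<^bsub>two\<^esub> b = (a \<and> b)" "\<top>\<^bsub>two\<^esub> = True"
proof -
  interpret partial_order two by (rule partial_order_two)
  show "carrier two = UNIV" by (simp add: two_def)
  show "\<Squnion>\<^bsub>two\<^esub> S = (True \<in> S)"
    by (rule sup_eqI) (auto simp: two_def)
  show "a \<sqinter>\<^bsub>two\<^esub> b = (a \<and> b)"
    by (rule meet_eqI) (auto simp: two_def)
  show "\<top>\<^bsub>two\<^esub> = True"
    by (rule top_eqI) (auto simp: two_def)
qed

lemma frame_two: "frame two"
proof -
  interpret complete_lattice two
  proof (rule partial_order.complete_lattice_from_sups[OF partial_order_two])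
    fix A :: "bool set"
    show "\<exists>s\<in>carrier two. (\<forall>x\<in>A. x \<sqsubseteq>\<^bsub>two\<^esub> s) \<and>
      (\<forall>y\<in>carrier two. (\<forall>x\<in>A. x \<sqsubseteq>\<^bsub>two\<^esub> y) \<longrightarrow> s \<sqsubseteq>\<^bsub>two\<^esub> y)"
      by (intro bexI[of _ "True \<in> A"]) (auto simp: two_def)
  qed
  show ?thesis by unfold_locales (auto simp: two_simps)
qed

lemma openin_pt:
  assumes "frame F"
  shows "openin (pt F) U \<longleftrightarrow> (\<exists>a\<in>carrier F. U = {p \<in> points F. p a})"
proof -
  interpret frame F by fact
  let ?t = "\<lambda>a. {p \<in> points F. p a}"
  have pm: "p (a \<sqinter>\<^bsub>F\<^esub> b) \<longleftrightarrow> p a \<and> p b" if "p \<in> points F" "a \<in> carrier F" "b \<in> carrier F" for p a b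
    using that by (simp add: points_def frame_hom_def two_simps)
  have ps: "p (\<Squnion>\<^bsub>F\<^esub> S) \<longleftrightarrow> (\<exists>a\<in>S. p a)" if "p \<in> points F" "S \<subseteq> carrier F" for p S
  proof -
    have "p (\<Squnion>\<^bsub>F\<^esub> S) = (True \<in> p ` S)"
      using that by (simp add: points_def frame_hom_def two_simps)
    then show ?thesis by auto
  qed
  have Int: "?t a \<inter> ?t b = ?t (a \<sqinter>\<^bsub>F\<^esub> b)" if "a \<in> carrier F" "b \<in> carrier F" for a b
    using that pm by blast
  have Un: "\<Union>(?t ` S) = ?t (\<Squnion>\<^bsub>F\<^esub> S)" if "S \<subseteq> carrier F" for S
    using that ps by blast
  have "istopology (\<lambda>U. \<exists>a\<in>carrier F. U = ?t a)"
    unfolding istopology_def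
  proof (intro conjI allI impI)
    fix U V assume "\<exists>a\<in>carrier F. U = ?t a" "\<exists>a\<in>carrier F. V = ?t a"
    then obtain a b where ab: "a \<in> carrier F" "b \<in> carrier F" and UV: "U = ?t a" "V = ?t b"
      by blast
    show "\<exists>a\<in>carrier F. U \<inter> V = ?t a"
      unfolding UV by (rule bexI, rule Int[OF ab], rule meet_closed[OF ab])
  next
    fix \<K> assume *: "\<forall>K\<in>\<K>. \<exists>a\<in>carrier F. K = ?t a"
    define S where "S = {a \<in> carrier F. ?t a \<in> \<K>}"
    have S: "S \<subseteq> carrier F" by (auto simp: S_def)
    have "?t ` S = \<K>"
    proof (intro subset_antisym subsetI)
      show "K \<in> \<K>" if "K \<in> ?t ` S" for K using that unfolding S_def by blast
      show "K \<in> ?t ` S" if K: "K \<in> \<K>" for K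
      proof -
        obtain a where a: "a \<in> carrier F" "K = ?t a" using * K by blast
        then have "a \<in> S" using K unfolding S_def by simp
        then show ?thesis unfolding a(2) by (rule imageI)
      qed
    qed
    then have "\<Union>\<K> = ?t (\<Squnion>\<^bsub>F\<^esub> S)" using Un[OF S] by (simp only:)
    then show "\<exists>a\<in>carrier F. \<Union>\<K> = ?t a"
      by (rule bexI) (rule sup_closed[OF S])
  qed
  from topology_inverse'[OF this] show ?thesis unfolding pt_def by (simp only:)
qed

lemma topspace_pt:
  assumes "frame F"
  shows "topspace (pt F) = points F"
proof -
  interpret frame F by fact
  have "points F = {p \<in> points F. p \<top>\<^bsub>F\<^esub>}"
    by (auto simp: points_def frame_hom_def two_simps)
  then have "openin (pt F) (points F)"
    using openin_pt[OF assms] top_closed by blast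
  moreover have "topspace (pt F) \<subseteq> points F"
    using openin_topspace[of "pt F"] unfolding openin_pt[OF assms] by auto
  ultimately show ?thesis by (simp add: openin_subset subset_antisym)
qed


section \<open>Universal property of presented frames\<close>

lemma frame_hom_comp:
  assumes h: "frame_hom F K h" and k: "frame_hom K M k"
  shows "frame_hom F M (\<lambda>x. k (h x))"
proof -
  have "h ` S \<subseteq> carrier K" if "S \<subseteq> carrier F" for S
    using h that by (auto simp: frame_hom_def)
  then have "k (h (\<Squnion>\<^bsub>F\<^esub> S)) = \<Squnion>\<^bsub>M\<^esub> ((\<lambda>x. k (h x)) ` S)" if "S \<subseteq> carrier F" for S
    using h k that by (simp add: frame_hom_def image_image)
  then show ?thesis
    using h k by (auto simp: frame_hom_def Pi_iff)
qed

context frame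
begin

lemma meet_absorb: "\<lbrakk>x \<sqsubseteq> y; x \<in> carrier L; y \<in> carrier L\<rbrakk> \<Longrightarrow> x \<sqinter> y = x"
  by (metis le_iff_join)

context
  fixes \<theta> assumes cong: "frame_congruence L \<theta>"
begin

lemma cong_equiv: "equiv (carrier L) \<theta>"
  using cong by (simp add: frame_congruence_def)

lemma cong_carrier: "(a, b) \<in> \<theta> \<Longrightarrow> a \<in> carrier L \<and> b \<in> carrier L"
  using cong_equiv by (auto simp: equiv_def)

lemma cong_refl: "a \<in> carrier L \<Longrightarrow> (a, a) \<in> \<theta>"
  using cong_equiv by (auto simp: equiv_def refl_on_def)

lemma cong_sym: "(a, b) \<in> \<theta> \<Longrightarrow> (b, a) \<in> \<theta>"
  using cong_equiv by (auto simp: equiv_def sym_def)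

lemma cong_trans: "(a, b) \<in> \<theta> \<Longrightarrow> (b, c) \<in> \<theta> \<Longrightarrow> (a, c) \<in> \<theta>"
  using cong_equiv unfolding equiv_def trans_def by blast

lemma cong_meet:
  assumes "(a, a') \<in> \<theta>" "(b, b') \<in> \<theta>"
  shows "(a \<sqinter> b, a' \<sqinter> b') \<in> \<theta>"
proof -
  have "\<forall>(a, a')\<in>\<theta>. \<forall>(b, b')\<in>\<theta>. (a \<sqinter> b, a' \<sqinter> b') \<in> \<theta>"
    using cong[unfolded frame_congruence_def] by (elim conjE)
  from bspec[OF bspec[OF this assms(1), simplified prod.case] assms(2)]
  show ?thesis by (simp only: prod.case)
qed

lemma cong_sup:
  assumes "\<And>i. i \<in> I \<Longrightarrow> (f i, g i) \<in> \<theta>"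
  shows "(\<Squnion>(f ` I), \<Squnion>(g ` I)) \<in> \<theta>"
proof -
  let ?P = "(\<lambda>i. (f i, g i)) ` I"
  have "?P \<subseteq> \<theta>" using assms by auto
  then have "(\<Squnion>(fst ` ?P), \<Squnion>(snd ` ?P)) \<in> \<theta>"
    using cong unfolding frame_congruence_def by blast
  then show ?thesis by (simp add: image_image)
qed

abbreviation (input) cls where "cls a \<equiv> \<theta> `` {a}"

lemma cls_eq_iff: "a \<in> carrier L \<Longrightarrow> b \<in> carrier L \<Longrightarrow> cls a = cls b \<longleftrightarrow> (a, b) \<in> \<theta>"
  using eq_equiv_class_iff[OF cong_equiv] by blast

lemma quotient_carrier: "carrier (quotient_frame L \<theta>) = cls ` carrier L"
  by (auto simp: quotient_frame_def quotient_def)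

lemma quotient_rep: "x \<in> carrier (quotient_frame L \<theta>) \<Longrightarrow> \<exists>a. a \<in> carrier L \<and> x = cls a"
  unfolding quotient_carrier by blast

lemma quotient_le_iff:
  assumes "a \<in> carrier L" "b \<in> carrier L"
  shows "cls a \<sqsubseteq>\<^bsub>quotient_frame L \<theta>\<^esub> cls b \<longleftrightarrow> (a \<sqinter> b, a) \<in> \<theta>"
proof
  assume "cls a \<sqsubseteq>\<^bsub>quotient_frame L \<theta>\<^esub> cls b"
  then obtain a' b' where *: "(a, a') \<in> \<theta>" "(b, b') \<in> \<theta>" "a' \<sqsubseteq> b'"
    by (auto simp: quotient_frame_def)
  then have "a' \<sqinter> b' = a'" by (intro meet_absorb) (auto dest: cong_carrier)
  then show "(a \<sqinter> b, a) \<in> \<theta>"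
    using cong_meet[OF *(1,2)] cong_sym[OF *(1)] cong_trans by metis
next
  assume "(a \<sqinter> b, a) \<in> \<theta>"
  then have "a \<sqinter> b \<in> cls a" "b \<in> cls b" "a \<sqinter> b \<sqsubseteq> b"
    using assms by (simp_all add: cong_sym cong_refl meet_right)
  then have "\<exists>a'\<in>cls a. \<exists>b'\<in>cls b. a' \<sqsubseteq> b'" by blast
  then show "cls a \<sqsubseteq>\<^bsub>quotient_frame L \<theta>\<^esub> cls b"
    by (simp add: quotient_frame_def)
qed

lemma quotient_partial_order: "partial_order (quotient_frame L \<theta>)"
proof -
  let ?Q = "quotient_frame L \<theta>"
  have eq: "eq ?Q = (=)" by (simp add: quotient_frame_def)
  have Qrefl: "x \<sqsubseteq>\<^bsub>?Q\<^esub> x" if x: "x \<in> carrier ?Q" for x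
  proof -
    obtain a where a: "a \<in> carrier L" "x = cls a"
      using quotient_rep[OF x] by blast
    have "a \<sqinter> a = a" by (rule meet_absorb) (use a(1) in auto)
    then show ?thesis using a(1) unfolding a(2) by (simp add: quotient_le_iff cong_refl)
  qed
  have Qanti: "x = y" if "x \<sqsubseteq>\<^bsub>?Q\<^esub> y" "y \<sqsubseteq>\<^bsub>?Q\<^esub> x"
    and car: "x \<in> carrier ?Q" "y \<in> carrier ?Q" for x y
  proof -
    obtain a b where ab: "a \<in> carrier L" "x = cls a" "b \<in> carrier L" "y = cls b"
      using quotient_rep[OF car(1)] quotient_rep[OF car(2)] by blast
    have "(a \<sqinter> b, a) \<in> \<theta>" "(b \<sqinter> a, b) \<in> \<theta>"
      using that(1,2) ab(1,3) unfolding ab(2,4) by (simp_all add: quotient_le_iff)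
    then have "(a, b) \<in> \<theta>" using meet_comm[of L a b] cong_sym cong_trans by metis
    then show ?thesis unfolding ab(2,4) using ab(1,3) by (simp add: cls_eq_iff)
  qed
  have Qtrans: "x \<sqsubseteq>\<^bsub>?Q\<^esub> z" if "x \<sqsubseteq>\<^bsub>?Q\<^esub> y" "y \<sqsubseteq>\<^bsub>?Q\<^esub> z"
    and car: "x \<in> carrier ?Q" "y \<in> carrier ?Q" "z \<in> carrier ?Q" for x y z
  proof -
    obtain a b c where ab: "a \<in> carrier L" "x = cls a" "b \<in> carrier L" "y = cls b"
        "c \<in> carrier L" "z = cls c"
      using quotient_rep[OF car(1)] quotient_rep[OF car(2)] quotient_rep[OF car(3)] by blast
    have *: "(a \<sqinter> b, a) \<in> \<theta>" "(b \<sqinter> c, b) \<in> \<theta>"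
      using that(1,2) ab(1,3,5) unfolding ab(2,4,6) by (simp_all add: quotient_le_iff)
    have "(a \<sqinter> (b \<sqinter> c), a \<sqinter> b) \<in> \<theta>" using cong_meet[OF cong_refl[OF ab(1)] *(2)] .
    moreover have "((a \<sqinter> b) \<sqinter> c, a \<sqinter> c) \<in> \<theta>" using cong_meet[OF *(1) cong_refl[OF ab(5)]] .
    ultimately have "(a \<sqinter> c, a) \<in> \<theta>"
      unfolding meet_assoc[OF ab(1,3,5)] using * cong_trans cong_sym by blast
    then show ?thesis unfolding ab(2,6) using ab(1,5) by (simp add: quotient_le_iff)
  qed
  show ?thesis
    by unfold_locales
      (unfold eq, (simp add: Qrefl; fail | erule (3) Qanti | erule (4) Qtrans)+)
qed

lemma quotient_sup_aux:
  assumes "S \<subseteq> carrier L"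
  shows "\<forall>x\<in>S. cls x \<sqsubseteq>\<^bsub>quotient_frame L \<theta>\<^esub> cls (\<Squnion>S)"
    "\<And>y. y \<in> carrier L \<Longrightarrow> (\<And>x. x \<in> S \<Longrightarrow> cls x \<sqsubseteq>\<^bsub>quotient_frame L \<theta>\<^esub> cls y) \<Longrightarrow>
      cls (\<Squnion>S) \<sqsubseteq>\<^bsub>quotient_frame L \<theta>\<^esub> cls y"
proof -
  have car: "\<Squnion>S \<in> carrier L" using assms by simp
  show "\<forall>x\<in>S. cls x \<sqsubseteq>\<^bsub>quotient_frame L \<theta>\<^esub> cls (\<Squnion>S)"
  proof
    fix x assume x: "x \<in> S"
    then have "x \<sqsubseteq> \<Squnion>S" "x \<in> carrier L" using assms sup_upper by auto
    then have "x \<sqinter> \<Squnion>S = x" using car by (intro meet_absorb)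
    then show "cls x \<sqsubseteq>\<^bsub>quotient_frame L \<theta>\<^esub> cls (\<Squnion>S)"
      using \<open>x \<in> carrier L\<close> car quotient_le_iff cong_refl by simp
  qed
  fix y assume y: "y \<in> carrier L" "\<And>x. x \<in> S \<Longrightarrow> cls x \<sqsubseteq>\<^bsub>quotient_frame L \<theta>\<^esub> cls y"
  have "(y \<sqinter> x, x) \<in> \<theta>" if "x \<in> S" for x
  proof -
    have "x \<in> carrier L" using that assms by blast
    then show ?thesis
      using y(2)[OF that] y(1) quotient_le_iff[of x y] meet_comm[of L x y] by simp
  qed
  then have "(\<Squnion>((\<lambda>x. y \<sqinter> x) ` S), \<Squnion>((\<lambda>x. x) ` S)) \<in> \<theta>" by (rule cong_sup)
  then have "(y \<sqinter> \<Squnion>S, \<Squnion>S) \<in> \<theta>" unfolding meet_sup_distrib[OF y(1) assms] by simp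
  then show "cls (\<Squnion>S) \<sqsubseteq>\<^bsub>quotient_frame L \<theta>\<^esub> cls y"
    using quotient_le_iff[OF car y(1)] meet_comm[of L y] by simp
qed

lemma quotient_sup:
  assumes "S \<subseteq> carrier L"
  shows "\<Squnion>\<^bsub>quotient_frame L \<theta>\<^esub> (cls ` S) = cls (\<Squnion>S)"
proof -
  interpret Q: partial_order "quotient_frame L \<theta>" by (rule quotient_partial_order)
  show ?thesis
  proof (rule Q.sup_eqI)
    show "cls ` S \<subseteq> carrier (quotient_frame L \<theta>)"
      unfolding quotient_carrier using assms by blast
    show "cls (\<Squnion>S) \<in> carrier (quotient_frame L \<theta>)"
      unfolding quotient_carrier using assms by simp
    show "x \<sqsubseteq>\<^bsub>quotient_frame L \<theta>\<^esub> cls (\<Squnion>S)" if "x \<in> cls ` S" for x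
      using that quotient_sup_aux(1)[OF assms] by blast
    fix y assume y: "y \<in> carrier (quotient_frame L \<theta>)"
      "\<And>x. x \<in> cls ` S \<Longrightarrow> x \<sqsubseteq>\<^bsub>quotient_frame L \<theta>\<^esub> y"
    obtain c where c: "c \<in> carrier L" "y = cls c" using quotient_rep[OF y(1)] by blast
    show "cls (\<Squnion>S) \<sqsubseteq>\<^bsub>quotient_frame L \<theta>\<^esub> y"
      unfolding c(2) by (rule quotient_sup_aux(2)[OF assms c(1)]) (use y(2) c(2) in blast)
  qed
qed

lemma quotient_meet:
  assumes "a \<in> carrier L" "b \<in> carrier L"
  shows "cls a \<sqinter>\<^bsub>quotient_frame L \<theta>\<^esub> cls b = cls (a \<sqinter> b)"
proof -
  let ?Q = "quotient_frame L \<theta>"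
  interpret Q: partial_order ?Q by (rule quotient_partial_order)
  have ab: "a \<sqinter> b \<in> carrier L" using assms by simp
  have le: "cls x \<sqsubseteq>\<^bsub>?Q\<^esub> cls y" if "x \<sqsubseteq> y" "x \<in> carrier L" "y \<in> carrier L" for x y
  proof -
    have "x \<sqinter> y = x" using that by (rule meet_absorb)
    then show ?thesis using that by (simp add: quotient_le_iff cong_refl)
  qed
  show ?thesis
  proof (rule Q.meet_eqI)
    fix y assume y: "y \<in> carrier ?Q" "y \<sqsubseteq>\<^bsub>?Q\<^esub> cls a" "y \<sqsubseteq>\<^bsub>?Q\<^esub> cls b"
    then obtain c where c: "c \<in> carrier L" "y = cls c" using quotient_rep by blast
    have *: "(c \<sqinter> a, c) \<in> \<theta>" "(c \<sqinter> b, c) \<in> \<theta>"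
      using y(2,3) assms c(1) unfolding c(2) by (simp_all add: quotient_le_iff)
    have "((c \<sqinter> a) \<sqinter> b, c \<sqinter> b) \<in> \<theta>" using cong_meet[OF *(1) cong_refl[OF assms(2)]] .
    then have "(c \<sqinter> (a \<sqinter> b), c) \<in> \<theta>"
      unfolding meet_assoc[OF c(1) assms] using *(2) cong_trans by blast
    then show "y \<sqsubseteq>\<^bsub>?Q\<^esub> cls (a \<sqinter> b)"
      using c(1) ab unfolding c(2) by (simp add: quotient_le_iff)
  qed (use assms ab in \<open>simp_all add: quotient_carrier le meet_left meet_right\<close>)
qed

lemma quotient_top: "\<top>\<^bsub>quotient_frame L \<theta>\<^esub> = cls \<top>"
proof -
  interpret Q: partial_order "quotient_frame L \<theta>" by (rule quotient_partial_order)
  show ?thesis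
  proof (rule Q.top_eqI)
    fix y assume "y \<in> carrier (quotient_frame L \<theta>)"
    then obtain c where c: "c \<in> carrier L" "y = cls c" using quotient_rep by blast
    have "c \<sqinter> \<top> = c" by (rule meet_absorb) (use c(1) in auto)
    then show "y \<sqsubseteq>\<^bsub>quotient_frame L \<theta>\<^esub> cls \<top>"
      using c(1) unfolding c(2) by (simp add: quotient_le_iff cong_refl)
  qed (simp add: quotient_carrier)
qed

lemma frame_hom_quotient: "frame_hom L (quotient_frame L \<theta>) (\<lambda>a. \<theta> `` {a})"
  unfolding frame_hom_def
  by (simp add: quotient_carrier quotient_top quotient_meet quotient_sup)

lemma frame_quotient: "frame (quotient_frame L \<theta>)"
proof -
  let ?Q = "quotient_frame L \<theta>"
  have lift: "\<exists>T. T \<subseteq> carrier L \<and> S = cls ` T" if "S \<subseteq> carrier ?Q" for S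
    using that unfolding quotient_carrier by (rule subset_imageE) auto
  interpret Q: complete_lattice ?Q
  proof (rule partial_order.complete_lattice_from_sups[OF quotient_partial_order])
    fix S assume "S \<subseteq> carrier ?Q"
    then obtain T where T: "T \<subseteq> carrier L" "S = cls ` T" using lift by blast
    have "\<forall>y\<in>carrier ?Q. (\<forall>x\<in>S. x \<sqsubseteq>\<^bsub>?Q\<^esub> y) \<longrightarrow> cls (\<Squnion>T) \<sqsubseteq>\<^bsub>?Q\<^esub> y"
    proof (intro ballI impI)
      fix y assume y: "y \<in> carrier ?Q" "\<forall>x\<in>S. x \<sqsubseteq>\<^bsub>?Q\<^esub> y"
      obtain c where c: "c \<in> carrier L" "y = cls c" using quotient_rep[OF y(1)] by blast
      show "cls (\<Squnion>T) \<sqsubseteq>\<^bsub>?Q\<^esub> y"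
        unfolding c(2) by (rule quotient_sup_aux(2)[OF T(1) c(1)]) (use y(2) c(2) T(2) in blast)
    qed
    moreover have "\<forall>x\<in>S. x \<sqsubseteq>\<^bsub>?Q\<^esub> cls (\<Squnion>T)"
      using quotient_sup_aux(1)[OF T(1)] unfolding T(2) by blast
    moreover have "cls (\<Squnion>T) \<in> carrier ?Q"
      unfolding quotient_carrier using T(1) by simp
    ultimately show "\<exists>s\<in>carrier ?Q. (\<forall>x\<in>S. x \<sqsubseteq>\<^bsub>?Q\<^esub> s) \<and>
      (\<forall>y\<in>carrier ?Q. (\<forall>x\<in>S. x \<sqsubseteq>\<^bsub>?Q\<^esub> y) \<longrightarrow> s \<sqsubseteq>\<^bsub>?Q\<^esub> y)"
      by blast
  qed
  show ?thesis
  proof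
    fix a S assume "a \<in> carrier ?Q" "S \<subseteq> carrier ?Q"
    then obtain b T where T: "T \<subseteq> carrier L" "S = cls ` T" and b: "b \<in> carrier L" "a = cls b"
      using lift quotient_rep by metis
    have 1: "(\<lambda>s. a \<sqinter>\<^bsub>?Q\<^esub> s) ` S = cls ` ((\<lambda>t. b \<sqinter> t) ` T)"
      unfolding T(2) b(2) image_image
      by (rule image_cong) (use T(1) b(1) in \<open>auto intro!: quotient_meet\<close>)
    have 2: "(\<lambda>t. b \<sqinter> t) ` T \<subseteq> carrier L" using T(1) b(1) by auto
    show "a \<sqinter>\<^bsub>?Q\<^esub> \<Squnion>\<^bsub>?Q\<^esub> S = \<Squnion>\<^bsub>?Q\<^esub> ((\<lambda>s. a \<sqinter>\<^bsub>?Q\<^esub> s) ` S)"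
      unfolding 1 quotient_sup[OF 2] unfolding T(2) b(2) quotient_sup[OF T(1)]
      using T(1) b(1) by (simp add: quotient_meet meet_sup_distrib)
  qed
qed

end

end

lemma frame_congruence_generated:
  assumes "frame F" "R \<subseteq> carrier F \<times> carrier F"
  shows "frame_congruence F (generated_congruence F R)" "R \<subseteq> generated_congruence F R"
proof -
  interpret frame F by fact
  let ?\<Gamma> = "generated_congruence F R"
  show "R \<subseteq> ?\<Gamma>" by (auto simp: generated_congruence_def)
  have full: "frame_congruence F (carrier F \<times> carrier F)"
  proof -
    have "\<Squnion>\<^bsub>F\<^esub> (fst ` P) \<in> carrier F \<and> \<Squnion>\<^bsub>F\<^esub> (snd ` P) \<in> carrier F"
      if "P \<subseteq> carrier F \<times> carrier F" for P
      using that by (intro conjI sup_closed) auto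
    then show ?thesis
      by (auto simp: frame_congruence_def equiv_def refl_on_def sym_def trans_def)
  qed
  have sub: "?\<Gamma> \<subseteq> \<theta>" if "frame_congruence F \<theta>" "R \<subseteq> \<theta>" for \<theta>
    using that by (auto simp: generated_congruence_def)
  have mem: "x \<in> ?\<Gamma>" if "\<And>\<theta>. frame_congruence F \<theta> \<Longrightarrow> R \<subseteq> \<theta> \<Longrightarrow> x \<in> \<theta>" for x
    using that by (auto simp: generated_congruence_def)
  show "frame_congruence F ?\<Gamma>"
    unfolding frame_congruence_def
  proof (intro conjI ballI allI impI)
    show "equiv (carrier F) ?\<Gamma>"
    proof (rule equivI)
      show "?\<Gamma> \<subseteq> carrier F \<times> carrier F" using sub[OF full assms(2)] .
      show "refl_on (carrier F) ?\<Gamma>"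
        by (rule refl_onI) (auto intro!: mem cong_refl)
      show "sym ?\<Gamma>"
        by (rule symI) (meson mem sub subsetD cong_sym)
      show "trans ?\<Gamma>"
        by (rule transI) (meson mem sub subsetD cong_trans)
    qed
  next
    have "(a \<sqinter>\<^bsub>F\<^esub> b, a' \<sqinter>\<^bsub>F\<^esub> b') \<in> ?\<Gamma>"
      if "(a, a') \<in> ?\<Gamma>" "(b, b') \<in> ?\<Gamma>" for a a' b b'
      using that by (meson mem sub subsetD cong_meet)
    then show "case x of (a, a') \<Rightarrow> \<forall>(b, b')\<in>?\<Gamma>. (a \<sqinter>\<^bsub>F\<^esub> b, a' \<sqinter>\<^bsub>F\<^esub> b') \<in> ?\<Gamma>"
      if "x \<in> ?\<Gamma>" for x
      using that by blast
  next
    fix P assume P: "P \<subseteq> ?\<Gamma>"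
    show "(\<Squnion>\<^bsub>F\<^esub> (fst ` P), \<Squnion>\<^bsub>F\<^esub> (snd ` P)) \<in> ?\<Gamma>"
    proof (rule mem)
      fix \<theta> assume \<theta>: "frame_congruence F \<theta>" "R \<subseteq> \<theta>"
      then have "P \<subseteq> \<theta>" using P sub by blast
      then show "(\<Squnion>\<^bsub>F\<^esub> (fst ` P), \<Squnion>\<^bsub>F\<^esub> (snd ` P)) \<in> \<theta>"
        using \<theta>(1) unfolding frame_congruence_def by blast
    qed
  qed
qed

lemma frame_homD:
  assumes "frame_hom F K h"
  shows "a \<in> carrier F \<Longrightarrow> h a \<in> carrier K"
    "h \<top>\<^bsub>F\<^esub> = \<top>\<^bsub>K\<^esub>"
    "a \<in> carrier F \<Longrightarrow> b \<in> carrier F \<Longrightarrow> h (a \<sqinter>\<^bsub>F\<^esub> b) = h a \<sqinter>\<^bsub>K\<^esub> h b"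
    "S \<subseteq> carrier F \<Longrightarrow> h (\<Squnion>\<^bsub>F\<^esub> S) = \<Squnion>\<^bsub>K\<^esub> (h ` S)"
  using assms unfolding frame_hom_def by blast+

lemma frame_homI:
  assumes "\<And>a. a \<in> carrier F \<Longrightarrow> h a \<in> carrier K"
    "h \<top>\<^bsub>F\<^esub> = \<top>\<^bsub>K\<^esub>"
    "\<And>a b. a \<in> carrier F \<Longrightarrow> b \<in> carrier F \<Longrightarrow> h (a \<sqinter>\<^bsub>F\<^esub> b) = h a \<sqinter>\<^bsub>K\<^esub> h b"
    "\<And>S. S \<subseteq> carrier F \<Longrightarrow> h (\<Squnion>\<^bsub>F\<^esub> S) = \<Squnion>\<^bsub>K\<^esub> (h ` S)"
  shows "frame_hom F K h"
  using assms unfolding frame_hom_def by blast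

lemma free_carrier:
  "D \<in> carrier (free_frame G) \<longleftrightarrow>
    D \<subseteq> Fpow G \<and> (\<forall>A\<in>D. \<forall>B\<in>Fpow G. A \<subseteq> B \<longrightarrow> B \<in> D)"
  by (simp add: free_frame_def set_order_def)

lemma free_upward:
  "\<lbrakk>D \<in> carrier (free_frame G); A \<in> D; B \<in> Fpow G; A \<subseteq> B\<rbrakk> \<Longrightarrow> B \<in> D"
  unfolding free_carrier by blast

lemma free_sup: "S \<subseteq> carrier (free_frame G) \<Longrightarrow> \<Squnion>\<^bsub>free_frame G\<^esub> S = \<Union>S"
  unfolding free_frame_def by (rule set_frame.sup_eq[OF set_frame_free]) (simp add: set_order_def)

lemma free_meet:
  "\<lbrakk>D \<in> carrier (free_frame G); E \<in> carrier (free_frame G)\<rbrakk> \<Longrightarrow> D \<sqinter>\<^bsub>free_frame G\<^esub> E = D \<inter> E"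
  unfolding free_frame_def by (rule set_frame.meet_eq[OF set_frame_free]) (simp_all add: set_order_def)

lemma free_top: "\<top>\<^bsub>free_frame G\<^esub> = Fpow G"
  unfolding free_frame_def set_frame.top_eq[OF set_frame_free] by blast

lemma free_gen_carrier: "free_gen G g \<in> carrier (free_frame G)"
  by (auto simp: free_carrier free_gen_def)

lemma free_frame_hom_unique:
  assumes "frame_hom (free_frame G) K h" "frame_hom (free_frame G) K k"
    and gen: "\<And>g. g \<in> G \<Longrightarrow> h (free_gen G g) = k (free_gen G g)"
    and D: "D \<in> carrier (free_frame G)"
  shows "h D = k D"
proof -
  define up where "up A = {B \<in> Fpow G. A \<subseteq> B}" for A
  have up_car: "up A \<in> carrier (free_frame G)" for A
    by (auto simp: free_carrier up_def)
  have up: "h (up A) = k (up A)" if "finite A" "A \<subseteq> G" for A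
    using that
  proof (induction A)
    case empty
    have "up {} = \<top>\<^bsub>free_frame G\<^esub>" by (simp add: up_def free_top)
    then show ?case using assms(1,2) by (simp add: frame_homD(2))
  next
    case (insert g A)
    have "up (insert g A) = free_gen G g \<inter> up A" by (auto simp: up_def free_gen_def)
    also have "\<dots> = free_gen G g \<sqinter>\<^bsub>free_frame G\<^esub> up A"
      by (rule free_meet[symmetric]) (rule free_gen_carrier up_car)+
    finally have *: "up (insert g A) = free_gen G g \<sqinter>\<^bsub>free_frame G\<^esub> up A" .
    have "h (free_gen G g) = k (free_gen G g)" "h (up A) = k (up A)"
      using insert gen by auto
    then show ?case
      unfolding * by (simp add: frame_homD(3)[OF assms(1)] frame_homD(3)[OF assms(2)]
          free_gen_carrier up_car)
  qed
  have sub: "up ` D \<subseteq> carrier (free_frame G)" using up_car by blast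
  have D': "D \<subseteq> Fpow G" "\<And>A B. A \<in> D \<Longrightarrow> B \<in> Fpow G \<Longrightarrow> A \<subseteq> B \<Longrightarrow> B \<in> D"
    using D unfolding free_carrier by blast+
  have "D = \<Union>(up ` D)" using D' by (force simp: up_def)
  then have eq: "D = \<Squnion>\<^bsub>free_frame G\<^esub> (up ` D)" using free_sup[OF sub] by simp
  have "h ` up ` D = k ` up ` D"
    unfolding image_image by (rule image_cong) (use D'(1) up in \<open>auto simp: Fpow_def\<close>)
  then have "h (\<Squnion>\<^bsub>free_frame G\<^esub> (up ` D)) = k (\<Squnion>\<^bsub>free_frame G\<^esub> (up ` D))"
    by (simp add: frame_homD(4)[OF assms(1) sub] frame_homD(4)[OF assms(2) sub])
  then show ?thesis using eq by simp
qed

lemma (in frame) free_frame_hom_exists: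
  assumes f: "f \<in> G \<rightarrow> carrier L"
  shows "\<exists>h. frame_hom (free_frame G) L h \<and> (\<forall>g\<in>G. h (free_gen G g) = f g)"
proof -
  define m where "m A = \<Sqinter>(f ` A)" for A
  define h where "h D = \<Squnion>(m ` D)" for D
  have fsub: "f ` A \<subseteq> carrier L" if "A \<in> Fpow G" for A
    using that f by (auto simp: Fpow_def)
  have m_car: "m A \<in> carrier L" if "A \<in> Fpow G" for A
    unfolding m_def by (rule inf_closed[OF fsub[OF that]])
  have m_lower: "m A \<sqsubseteq> f g" if "A \<in> Fpow G" "g \<in> A" for A g
    unfolding m_def by (rule inf_lower[OF fsub[OF that(1)]]) (use that(2) in blast)
  have m_greatest: "z \<sqsubseteq> m A"
    if "A \<in> Fpow G" "z \<in> carrier L" "\<And>g. g \<in> A \<Longrightarrow> z \<sqsubseteq> f g" for A z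
    unfolding m_def by (rule inf_greatest[OF fsub[OF that(1)] that(2)]) (use that(3) in blast)
  have m_mono: "m B \<sqsubseteq> m A" if "A \<in> Fpow G" "B \<in> Fpow G" "A \<subseteq> B" for A B
    by (rule m_greatest[OF that(1) m_car[OF that(2)]]) (use m_lower that in blast)
  have un: "A \<union> B \<in> Fpow G" if "A \<in> Fpow G" "B \<in> Fpow G" for A B
    using that by (auto simp: Fpow_def)
  have m_meet: "m B \<sqinter> m A \<sqsubseteq> m (A \<union> B)" if AB: "A \<in> Fpow G" "B \<in> Fpow G" for A B
  proof (rule m_greatest[OF un[OF AB]])
    have car: "m B \<sqinter> m A \<in> carrier L" by (rule meet_closed) (use AB m_car in blast)+
    then show "m B \<sqinter> m A \<in> carrier L" .
    fix g assume g: "g \<in> A \<union> B"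
    then have fg: "f g \<in> carrier L" using AB f by (auto simp: Fpow_def)
    show "m B \<sqinter> m A \<sqsubseteq> f g"
    proof (cases "g \<in> A")
      case True
      show ?thesis
        by (rule le_trans[OF meet_right[OF m_car[OF AB(2)] m_car[OF AB(1)]] m_lower[OF AB(1) True]
              car m_car[OF AB(1)] fg])
    next
      case False
      then have "g \<in> B" using g by blast
      show ?thesis
        by (rule le_trans[OF meet_left[OF m_car[OF AB(2)] m_car[OF AB(1)]] m_lower[OF AB(2) \<open>g \<in> B\<close>]
              car m_car[OF AB(2)] fg])
    qed
  qed
  have D_sub: "D \<subseteq> Fpow G" if "D \<in> carrier (free_frame G)" for D
    using that unfolding free_carrier by blast
  have msub: "m ` D \<subseteq> carrier L" if "D \<subseteq> Fpow G" for D
    using that m_car by blast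
  have h_car: "h D \<in> carrier L" if "D \<subseteq> Fpow G" for D
    unfolding h_def by (rule sup_closed[OF msub[OF that]])
  have h_upper: "m A \<sqsubseteq> h D" if "D \<subseteq> Fpow G" "A \<in> D" for A D
    unfolding h_def by (rule sup_upper[OF msub[OF that(1)]]) (use that(2) in blast)
  have h_least: "h D \<sqsubseteq> z"
    if "D \<subseteq> Fpow G" "z \<in> carrier L" "\<And>A. A \<in> D \<Longrightarrow> m A \<sqsubseteq> z" for D z
    unfolding h_def by (rule sup_least[OF msub[OF that(1)] that(2)]) (use that(3) in blast)
  have h_mono: "h D \<sqsubseteq> h E" if "D \<subseteq> E" "E \<subseteq> Fpow G" for D E
    by (rule h_least) (use that h_car h_upper in blast)+
  have "frame_hom (free_frame G) L h"
  proof (rule frame_homI)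
    show "h D \<in> carrier L" if "D \<in> carrier (free_frame G)" for D
      by (rule h_car[OF D_sub[OF that]])
    show "h \<top>\<^bsub>free_frame G\<^esub> = \<top>"
      unfolding free_top
    proof (rule le_antisym)
      have e: "{} \<in> Fpow G" by (simp add: Fpow_def)
      have "\<top> \<sqsubseteq> m {}" by (rule m_greatest[OF e]) simp_all
      then show "\<top> \<sqsubseteq> h (Fpow G)"
        by (rule le_trans[OF _ h_upper[OF subset_refl e]]) (use m_car[OF e] h_car in auto)
      show "h (Fpow G) \<sqsubseteq> \<top>" by (rule top_higher[OF h_car[OF subset_refl]])
    qed (use h_car in auto)
  next
    fix D E assume DE: "D \<in> carrier (free_frame G)" "E \<in> carrier (free_frame G)"
    note D = D_sub[OF DE(1)] and E = D_sub[OF DE(2)]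
    have DiE: "D \<inter> E \<subseteq> Fpow G" using D by blast
    have "h D \<sqinter> h E \<sqsubseteq> h (D \<inter> E)"
    proof -
      have 1: "m B \<sqinter> m A \<sqsubseteq> h (D \<inter> E)" if "A \<in> D" "B \<in> E" for A B
      proof -
        have AB: "A \<in> Fpow G" "B \<in> Fpow G" using that D E by blast+
        have "A \<union> B \<in> D" "A \<union> B \<in> E"
          by (rule free_upward[OF DE(1) that(1) un[OF AB] Un_upper1],
              rule free_upward[OF DE(2) that(2) un[OF AB] Un_upper2])
        then have ABDE: "A \<union> B \<in> D \<inter> E" by blast
        show ?thesis
          by (rule le_trans[OF m_meet[OF AB] h_upper[OF DiE ABDE]
                meet_closed[OF m_car[OF AB(2)] m_car[OF AB(1)]] m_car[OF un[OF AB]] h_car[OF DiE]])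
      qed
      have 2: "h D \<sqinter> m B \<sqsubseteq> h (D \<inter> E)" if "B \<in> E" for B
      proof -
        have B: "m B \<in> carrier L" using that E m_car by blast
        have "h D \<sqinter> m B = m B \<sqinter> h D" by (rule meet_comm)
        also have "\<dots> = \<Squnion>((\<lambda>x. m B \<sqinter> x) ` m ` D)"
          unfolding h_def by (rule meet_sup_distrib[OF B msub[OF D]])
        finally have *: "h D \<sqinter> m B = \<Squnion>((\<lambda>x. m B \<sqinter> x) ` m ` D)" .
        show ?thesis
          unfolding *
        proof (rule sup_least)
          show "(\<lambda>x. m B \<sqinter> x) ` m ` D \<subseteq> carrier L"
            using msub[OF D] B by (blast intro: meet_closed)
          show "h (D \<inter> E) \<in> carrier L" by (rule h_car[OF DiE])
        qed (use 1 that in blast)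
      qed
      have *: "h D \<sqinter> h E = \<Squnion>((\<lambda>x. h D \<sqinter> x) ` m ` E)"
        unfolding h_def[of E] by (rule meet_sup_distrib[OF h_car[OF D] msub[OF E]])
      show ?thesis
        unfolding *
      proof (rule sup_least)
        show "(\<lambda>x. h D \<sqinter> x) ` m ` E \<subseteq> carrier L"
          using msub[OF E] h_car[OF D] by (blast intro: meet_closed)
        show "h (D \<inter> E) \<in> carrier L" by (rule h_car[OF DiE])
      qed (use 2 in blast)
    qed
    moreover have "h (D \<inter> E) \<sqsubseteq> h D \<sqinter> h E"
      by (rule meet_le[OF h_mono h_mono h_car h_car h_car]) (use D E in blast)+
    ultimately show "h (D \<sqinter>\<^bsub>free_frame G\<^esub> E) = h D \<sqinter> h E"
      unfolding free_meet[OF DE]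
      by (intro le_antisym meet_closed h_car D E DiE)
  next
    fix S assume S: "S \<subseteq> carrier (free_frame G)"
    have S1: "D \<subseteq> Fpow G" if "D \<in> S" for D using that S D_sub by blast
    have S2: "\<Union>S \<subseteq> Fpow G" using S1 by blast
    have hS: "h ` S \<subseteq> carrier L" using S1 h_car by blast
    show "h (\<Squnion>\<^bsub>free_frame G\<^esub> S) = \<Squnion>(h ` S)"
      unfolding free_sup[OF S]
    proof (rule le_antisym)
      show "h (\<Union>S) \<sqsubseteq> \<Squnion>(h ` S)"
      proof (rule h_least[OF S2 sup_closed[OF hS]])
        fix A assume "A \<in> \<Union>S"
        then obtain D where D: "D \<in> S" "A \<in> D" by blast
        have hD: "h D \<in> h ` S" using D(1) by (rule imageI)
        have "A \<in> Fpow G" using D S1 by blast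
        show "m A \<sqsubseteq> \<Squnion>(h ` S)"
          by (rule le_trans[OF h_upper[OF S1[OF D(1)] D(2)] sup_upper[OF hS hD]
                m_car[OF \<open>A \<in> Fpow G\<close>] h_car[OF S1[OF D(1)]] sup_closed[OF hS]])
      qed
      show "\<Squnion>(h ` S) \<sqsubseteq> h (\<Union>S)"
      proof (rule sup_least[OF hS h_car[OF S2]])
        fix x assume "x \<in> h ` S"
        then obtain D where D: "D \<in> S" "x = h D" by blast
        show "x \<sqsubseteq> h (\<Union>S)" unfolding D(2) by (rule h_mono[OF Union_upper[OF D(1)] S2])
      qed
    qed (rule h_car[OF S2] sup_closed[OF hS])+
  qed
  moreover have "h (free_gen G g) = f g" if g: "g \<in> G" for g
  proof (rule le_antisym)
    have sub: "free_gen G g \<subseteq> Fpow G" by (auto simp: free_gen_def)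
    have fg: "f g \<in> carrier L" using f g by blast
    have gg: "{g} \<in> Fpow G" using g by (simp add: Fpow_def)
    have "{g} \<in> free_gen G g" using gg by (simp add: free_gen_def)
    have "f g \<sqsubseteq> m {g}" by (rule m_greatest[OF gg fg]) (use fg in auto)
    then show "f g \<sqsubseteq> h (free_gen G g)"
      by (rule le_trans[OF _ h_upper[OF sub \<open>{g} \<in> free_gen G g\<close>] fg m_car[OF gg] h_car[OF sub]])
    show "h (free_gen G g) \<sqsubseteq> f g"
      by (rule h_least[OF sub fg]) (use m_lower in \<open>auto simp: free_gen_def\<close>)
    show "h (free_gen G g) \<in> carrier L" by (rule h_car[OF sub])
    show "f g \<in> carrier L" by (rule fg)
  qed
  ultimately show ?thesis by blast
qed

theorem free_frame_universal:
  assumes "frame K" "f \<in> G \<rightarrow> carrier K"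
  shows "\<exists>!h. h \<in> extensional (carrier (free_frame G)) \<and> frame_hom (free_frame G) K h \<and>
    (\<forall>g\<in>G. h (free_gen G g) = f g)"
proof -
  obtain h where h: "frame_hom (free_frame G) K h" "\<And>g. g \<in> G \<Longrightarrow> h (free_gen G g) = f g"
    using frame.free_frame_hom_exists[OF assms] by blast
  interpret F: frame "free_frame G" by (rule frame_free_frame)
  let ?r = "restrict h (carrier (free_frame G))"
  have "frame_hom (free_frame G) K ?r"
  proof (rule frame_homI)
    fix S assume S: "S \<subseteq> carrier (free_frame G)"
    then have "?r ` S = h ` S" by (intro image_cong) auto
    then show "?r (\<Squnion>\<^bsub>free_frame G\<^esub> S) = \<Squnion>\<^bsub>K\<^esub> (?r ` S)"
      using S frame_homD(4)[OF h(1) S] by simp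
  qed (use frame_homD(1,2,3)[OF h(1)] in simp_all)
  then show ?thesis
  proof (intro ex1I[of _ ?r] conjI ballI, goal_cases)
    case (3 g)
    then show ?case by (simp add: free_gen_carrier h(2))
  next
    case (4 k)
    then have k: "k \<in> extensional (carrier (free_frame G))" "frame_hom (free_frame G) K k"
      "\<And>g. g \<in> G \<Longrightarrow> k (free_gen G g) = h (free_gen G g)"
      using h(2) by auto
    show ?case
      by (rule extensionalityI[OF k(1) restrict_extensional])
        (simp add: free_frame_hom_unique[OF k(2) h(1) k(3)])
  qed auto
qed

theorem frame_presented_frame:
  assumes "R \<subseteq> carrier (free_frame G) \<times> carrier (free_frame G)"
  shows "frame (presented_frame G R)"
  unfolding presented_frame_def
  by (rule frame.frame_quotient[OF frame_free_frame
        frame_congruence_generated(1)[OF frame_free_frame assms]])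

lemma (in frame) frame_congruence_kernel:
  assumes "frame_hom L K h"
  shows "frame_congruence L {(a, b). a \<in> carrier L \<and> b \<in> carrier L \<and> h a = h b}"
    (is "frame_congruence L ?ker")
  unfolding frame_congruence_def
proof (intro conjI allI impI)
  show "equiv (carrier L) ?ker"
    by (rule equivI) (auto intro!: refl_onI symI transI)
  show "\<forall>(a, a')\<in>?ker. \<forall>(b, b')\<in>?ker. (a \<sqinter> b, a' \<sqinter> b') \<in> ?ker"
    by (auto simp: frame_homD(3)[OF assms])
  fix P assume P: "P \<subseteq> ?ker"
  have 1: "fst ` P \<subseteq> carrier L" "snd ` P \<subseteq> carrier L" using P by auto
  have "h ` fst ` P = h ` snd ` P"
    unfolding image_image by (rule image_cong) (use P in auto)
  then show "(\<Squnion>(fst ` P), \<Squnion>(snd ` P)) \<in> ?ker"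
    using 1 by (simp add: frame_homD(4)[OF assms])
qed

theorem presented_frame_universal:
  assumes K: "frame K" and R: "R \<subseteq> carrier (free_frame G) \<times> carrier (free_frame G)"
    and f: "frame_hom (free_frame G) K f" and resp: "\<forall>(u, v)\<in>R. f u = f v"
  shows "\<exists>!h. h \<in> extensional (carrier (presented_frame G R)) \<and>
    frame_hom (presented_frame G R) K h \<and>
    (\<forall>g\<in>G. h (presented_gen G R g) = f (free_gen G g))"
proof -
  let ?L = "free_frame G" and ?P = "presented_frame G R"
  interpret frame ?L by (rule frame_free_frame)
  define \<theta> where "\<theta> = generated_congruence ?L R"
  have cong: "frame_congruence ?L \<theta>"
    unfolding \<theta>_def by (rule frame_congruence_generated(1)[OF frame_free_frame R])
  have P: "?P = quotient_frame ?L \<theta>" by (simp add: presented_frame_def \<theta>_def)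
  let ?cls = "\<lambda>u. \<theta> `` {u}"
  have car: "carrier ?P = ?cls ` carrier ?L" unfolding P by (rule quotient_carrier[OF cong])
  have gen: "presented_gen G R g = ?cls (free_gen G g)" for g
    by (simp add: presented_gen_def \<theta>_def)
  have hom: "frame_hom ?L ?P ?cls" unfolding P by (rule frame_hom_quotient[OF cong])
  have "R \<subseteq> {(a, b). a \<in> carrier ?L \<and> b \<in> carrier ?L \<and> f a = f b}"
    using R resp by auto
  then have \<theta>_ker: "\<theta> \<subseteq> {(a, b). a \<in> carrier ?L \<and> b \<in> carrier ?L \<and> f a = f b}"
    using frame_congruence_kernel[OF f] unfolding \<theta>_def generated_congruence_def by blast
  define h where "h = restrict (\<lambda>A. f (SOME a. a \<in> A)) (carrier ?P)"
  have h: "h (?cls u) = f u" if "u \<in> carrier ?L" for u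
  proof -
    have "u \<in> ?cls u" using cong_refl[OF cong that] by simp
    then have "(SOME a. a \<in> ?cls u) \<in> ?cls u" by (rule someI)
    then have "f (SOME a. a \<in> ?cls u) = f u" using \<theta>_ker by auto
    then show ?thesis using that car by (simp add: h_def)
  qed
  have "frame_hom ?P K h"
  proof (rule frame_homI)
    fix A assume "A \<in> carrier ?P"
    then obtain u where u: "u \<in> carrier ?L" "A = ?cls u" unfolding car by blast
    show "h A \<in> carrier K" unfolding u(2) h[OF u(1)] by (rule frame_homD(1)[OF f u(1)])
    fix B assume "B \<in> carrier ?P"
    then obtain v where v: "v \<in> carrier ?L" "B = ?cls v" unfolding car by blast
    show "h (A \<sqinter>\<^bsub>?P\<^esub> B) = h A \<sqinter>\<^bsub>K\<^esub> h B"
      unfolding u(2) v(2) frame_homD(3)[OF hom u(1) v(1), symmetric] h[OF u(1)] h[OF v(1)]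
        h[OF meet_closed[OF u(1) v(1)]]
      by (rule frame_homD(3)[OF f u(1) v(1)])
  next
    show "h \<top>\<^bsub>?P\<^esub> = \<top>\<^bsub>K\<^esub>"
      unfolding frame_homD(2)[OF hom, symmetric] h[OF top_closed] by (rule frame_homD(2)[OF f])
  next
    fix S assume "S \<subseteq> carrier ?P"
    then obtain T where T: "T \<subseteq> carrier ?L" "S = ?cls ` T"
      unfolding car by (rule subset_imageE)
    have "h ` S = f ` T"
      unfolding T(2) image_image by (rule image_cong) (use T(1) h in auto)
    then show "h (\<Squnion>\<^bsub>?P\<^esub> S) = \<Squnion>\<^bsub>K\<^esub> (h ` S)"
      using frame_homD(4)[OF hom T(1)] h[OF sup_closed[OF T(1)]] frame_homD(4)[OF f T(1)] T(2)
      by simp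
  qed
  then show ?thesis
  proof (intro ex1I[of _ h] conjI ballI, goal_cases)
    case 1
    show ?case by (simp add: h_def)
  next
    case (3 g)
    show ?case unfolding gen by (rule h[OF free_gen_carrier])
  next
    case (4 k)
    have k1: "frame_hom ?L K (\<lambda>u. k (?cls u))" by (rule frame_hom_comp[OF hom]) (use 4 in blast)
    have k2: "k (?cls u) = f u" if "u \<in> carrier ?L" for u
      by (rule free_frame_hom_unique[OF k1 f _ that]) (use 4 gen in auto)
    have k3: "k \<in> extensional (carrier ?P)" using 4 by blast
    have h3: "h \<in> extensional (carrier ?P)" by (simp add: h_def)
    show ?case
      by (rule extensionalityI[OF k3 h3]) (auto simp: car h k2)
  qed auto
qed

lemma M_rels_carrier:
  fixes F :: "('a, 'c) gorder_scheme"
  shows "M_rels F \<subseteq> carrier (free_frame (M_gens F)) \<times> carrier (free_frame (M_gens F))"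
proof -
  interpret L: frame "free_frame (M_gens F)" by (rule frame_free_frame)
  have "\<Squnion>\<^bsub>free_frame (M_gens F)\<^esub> ((\<lambda>a. free_gen (M_gens F) (c a)) ` A)
      \<in> carrier (free_frame (M_gens F))" for c :: "'a \<Rightarrow> 'a modal" and A
    by (rule L.sup_closed) (auto simp: free_gen_carrier)
  then show ?thesis
    unfolding M_rels_def Let_def by (auto simp: free_gen_carrier)
qed

lemma frame_M_frame: "frame (M_frame F)"
  unfolding M_frame_def by (rule frame_presented_frame[OF M_rels_carrier])

end

theory Submission
  imports Defs "HOL-Analysis.Abstract_Topological_Spaces"
begin

text \<open>
  A point \<open>p\<close> of \<open>M (opn X)\<close> amounts to two Scott open families \<open>{a. p (Box a)}\<close> and
  \<open>{a. p (Dia a)}\<close> of open sets, linked by \<open>M\<^sub>2\<close> and \<open>M\<^sub>5\<close>. The corresponding \<open>W\<close>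
  consists of the sets that contain a closed set all of whose open neighbourhoods lie in the first
  family. Regularity writes an open set \<open>a\<close> as the directed union of the open sets whose
  closure is contained in \<open>a\<close>; by Scott openness this gives \<open>a \<in> W \<longleftrightarrow> p (Box a)\<close> and
  \<open>topspace X - a \<notin> W \<longleftrightarrow> p (Dia a)\<close>. In the other direction no point has to be built by hand:
  compactness of \<open>X\<close> says that the two kinds of subbasic open sets of \<open>D_kh X\<close> satisfy the
  relations of \<open>M (opn X)\<close>, so the universal property yields a frame homomorphism \<open>h\<close> from
  \<open>M (opn X)\<close> to the opens of \<open>D_kh X\<close>, and \<open>W\<close> is sent to the point \<open>m \<mapsto> (W \<in> h m)\<close>.
  This inverse is continuous because the preimage of the basic open set of \<open>m\<close> is \<open>h m\<close>.
\<close>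

section \<open>Frame homomorphisms and the relations of \<open>M_frame\<close>\<close>

lemma frame_hom_join:
  assumes "frame_hom F K h" "a \<in> carrier F" "b \<in> carrier F"
  shows "h (a \<squnion>\<^bsub>F\<^esub> b) = h a \<squnion>\<^bsub>K\<^esub> h b"
  using frame_homD(4)[OF assms(1), of "{a, b}"] assms(2,3) by (simp add: join_def)

lemma (in complete_lattice) sup_empty_eq_bottom: "\<Squnion>{} = \<bottom>"
  by (rule sup_eqI) auto

lemma frame_hom_bottom:
  assumes "frame F" "frame K" "frame_hom F K h"
  shows "h \<bottom>\<^bsub>F\<^esub> = \<bottom>\<^bsub>K\<^esub>"
proof -
  interpret F: frame F by fact
  interpret K: frame K by fact
  show ?thesis
    using frame_homD(4)[OF assms(3), of "{}"] by (simp add: F.sup_empty_eq_bottom K.sup_empty_eq_bottom)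
qed

text \<open>A frame homomorphism preserves every operation in which the relations are written, so
  each of them turns into an identity in \<open>K\<close> between values of \<open>\<beta>\<close>
  and \<open>\<delta>\<close>. For \<open>K\<close> the opens of \<open>D_kh X\<close> this is the
  list to verify before the universal property applies; for \<open>K = two\<close> it lists what a
  point satisfies.\<close>

lemma M_rels_respected_iff:
  fixes F :: "('a, 'c) gorder_scheme"
  assumes K: "frame K" and f: "frame_hom (free_frame (M_gens F)) K f"
    and box: "\<And>a. a \<in> carrier F \<Longrightarrow> f (free_gen (M_gens F) (Box a)) = \<beta> a"
    and dia: "\<And>a. a \<in> carrier F \<Longrightarrow> f (free_gen (M_gens F) (Dia a)) = \<delta> a"
    and F: "frame F"
  shows "(\<forall>(u, v)\<in>M_rels F. f u = f v) \<longleftrightarrow>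
    (\<forall>a\<in>carrier F. \<forall>b\<in>carrier F. \<beta> (a \<sqinter>\<^bsub>F\<^esub> b) \<sqinter>\<^bsub>K\<^esub> \<beta> a = \<beta> (a \<sqinter>\<^bsub>F\<^esub> b)) \<and>
    (\<forall>a\<in>carrier F. \<forall>b\<in>carrier F. a \<sqinter>\<^bsub>F\<^esub> b = \<bottom>\<^bsub>F\<^esub> \<longrightarrow> \<beta> a \<sqinter>\<^bsub>K\<^esub> \<delta> b = \<bottom>\<^bsub>K\<^esub>) \<and>
    (\<forall>A. directed_in F A \<longrightarrow> \<beta> (\<Squnion>\<^bsub>F\<^esub> A) = \<Squnion>\<^bsub>K\<^esub> (\<beta> ` A)) \<and>
    (\<forall>a\<in>carrier F. \<forall>b\<in>carrier F. \<delta> a \<sqinter>\<^bsub>K\<^esub> \<delta> (a \<squnion>\<^bsub>F\<^esub> b) = \<delta> a) \<and>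
    (\<forall>a\<in>carrier F. \<forall>b\<in>carrier F. a \<squnion>\<^bsub>F\<^esub> b = \<top>\<^bsub>F\<^esub> \<longrightarrow> \<beta> a \<squnion>\<^bsub>K\<^esub> \<delta> b = \<top>\<^bsub>K\<^esub>) \<and>
    (\<forall>A. directed_in F A \<longrightarrow> \<delta> (\<Squnion>\<^bsub>F\<^esub> A) = \<Squnion>\<^bsub>K\<^esub> (\<delta> ` A))"
proof -
  interpret F: frame F by fact
  let ?L = "free_frame (M_gens F)"
  let ?b = "\<lambda>a. free_gen (M_gens F) (Box a)" and ?d = "\<lambda>a. free_gen (M_gens F) (Dia a)"
  interpret L: frame ?L by (rule frame_free_frame)
  have gen: "free_gen (M_gens F) g \<in> carrier ?L" for g by (rule free_gen_carrier)
  have meet: "f (free_gen (M_gens F) g \<sqinter>\<^bsub>?L\<^esub> free_gen (M_gens F) h)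
      = f (free_gen (M_gens F) g) \<sqinter>\<^bsub>K\<^esub> f (free_gen (M_gens F) h)" for g h
    by (rule frame_homD(3)[OF f gen gen])
  have join: "f (free_gen (M_gens F) g \<squnion>\<^bsub>?L\<^esub> free_gen (M_gens F) h)
      = f (free_gen (M_gens F) g) \<squnion>\<^bsub>K\<^esub> f (free_gen (M_gens F) h)" for g h
    by (rule frame_hom_join[OF f gen gen])
  have A: "A \<subseteq> carrier F" if "directed_in F A" for A
    using that by (simp add: directed_in_def)
  have supb: "f (\<Squnion>\<^bsub>?L\<^esub> (?b ` A)) = \<Squnion>\<^bsub>K\<^esub> (\<beta> ` A)" if "directed_in F A" for A
  proof -
    have "f ` ?b ` A = \<beta> ` A"
      unfolding image_image by (rule image_cong) (use A[OF that] box in auto)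
    then show ?thesis using frame_homD(4)[OF f, of "?b ` A"] gen by auto
  qed
  have supd: "f (\<Squnion>\<^bsub>?L\<^esub> (?d ` A)) = \<Squnion>\<^bsub>K\<^esub> (\<delta> ` A)" if "directed_in F A" for A
  proof -
    have "f ` ?d ` A = \<delta> ` A"
      unfolding image_image by (rule image_cong) (use A[OF that] dia in auto)
    then show ?thesis using frame_homD(4)[OF f, of "?d ` A"] gen by auto
  qed
  have sup: "\<Squnion>\<^bsub>F\<^esub> A \<in> carrier F" if "directed_in F A" for A
    by (rule F.sup_closed[OF A[OF that]])
  note e = box dia meet join supb supd sup frame_hom_bottom[OF frame_free_frame K f]
    frame_homD(2)[OF f] F.meet_closed F.join_closed
  \<comment> \<open>\<open>M\<^sub>3\<close> and \<open>M\<^sub>6\<close> are indexed by a directed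
    set, the other four relations by a pair of elements.\<close>
  have ball_pairs1: "(\<forall>(u, v)\<in>{(g A, h A) |A. P A}. f u = f v) \<longleftrightarrow> (\<forall>A. P A \<longrightarrow> f (g A) = f (h A))"
    for g h :: "'a set \<Rightarrow> 'a modal set set" and P by auto
  have ball_pairs2: "(\<forall>(u, v)\<in>{(g a b, h a b) |a b. P a b}. f u = f v) \<longleftrightarrow>
      (\<forall>a b. P a b \<longrightarrow> f (g a b) = f (h a b))"
    for g h :: "'a \<Rightarrow> 'a \<Rightarrow> 'a modal set set" and P by auto
  show ?thesis
    unfolding M_rels_def Let_def ball_Un ball_pairs1 ball_pairs2 conj_assoc
    by (intro arg_cong2[where f = "(\<and>)"]) (simp_all add: e Ball_def imp_conjL)
qed

section \<open>Opens as a frame, and directed unions of open sets\<close>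

lemma opn_simps:
  "carrier (opn X) = {U. openin X U}"
  "\<lbrakk>openin X a; openin X b\<rbrakk> \<Longrightarrow> a \<sqinter>\<^bsub>opn X\<^esub> b = a \<inter> b"
  "\<lbrakk>openin X a; openin X b\<rbrakk> \<Longrightarrow> a \<squnion>\<^bsub>opn X\<^esub> b = a \<union> b"
  "(\<And>a. a \<in> S \<Longrightarrow> openin X a) \<Longrightarrow> \<Squnion>\<^bsub>opn X\<^esub> S = \<Union>S"
  "\<top>\<^bsub>opn X\<^esub> = topspace X"
  "\<bottom>\<^bsub>opn X\<^esub> = {}"
proof -
  interpret set_frame "{U. openin X U}" by (rule set_frame_opn)
  interpret complete_lattice "opn X" using frame_opn[of X] by (simp add: frame_def)
  show "carrier (opn X) = {U. openin X U}" by (simp add: opn_def set_order_def)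
  show "\<lbrakk>openin X a; openin X b\<rbrakk> \<Longrightarrow> a \<sqinter>\<^bsub>opn X\<^esub> b = a \<inter> b"
    unfolding opn_def by (rule meet_eq) auto
  show "\<lbrakk>openin X a; openin X b\<rbrakk> \<Longrightarrow> a \<squnion>\<^bsub>opn X\<^esub> b = a \<union> b"
    unfolding opn_def by (rule join_eq) auto
  show "(\<And>a. a \<in> S \<Longrightarrow> openin X a) \<Longrightarrow> \<Squnion>\<^bsub>opn X\<^esub> S = \<Union>S"
    unfolding opn_def by (rule sup_eq) auto
  show "\<top>\<^bsub>opn X\<^esub> = topspace X"
    unfolding opn_def top_eq by (auto dest: openin_subset)
  show "\<bottom>\<^bsub>opn X\<^esub> = {}"
    using sup_empty_eq_bottom sup_eq[of "{}"] by (simp add: opn_def)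
qed

lemma directed_in_opn:
  "directed_in (opn X) A \<longleftrightarrow>
    (\<forall>a\<in>A. openin X a) \<and> A \<noteq> {} \<and> (\<forall>x\<in>A. \<forall>y\<in>A. \<exists>z\<in>A. x \<subseteq> z \<and> y \<subseteq> z)"
  by (auto simp: directed_in_def opn_def set_order_def)

lemma directed_in_opnD:
  assumes "directed_in (opn X) A"
  shows "a \<in> A \<Longrightarrow> openin X a" "A \<noteq> {}"
    "\<lbrakk>x \<in> A; y \<in> A\<rbrakk> \<Longrightarrow> \<exists>z\<in>A. x \<subseteq> z \<and> y \<subseteq> z"
  using assms by (simp_all add: directed_in_opn)

text \<open>A finite subfamily that covers \<open>c\<close> has an upper bound in the directed
  family.\<close>

lemma compactin_directed_Union:
  assumes "compactin X c" "directed_in (opn X) A" "c \<subseteq> \<Union>A"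
  shows "\<exists>a\<in>A. c \<subseteq> a"
proof -
  have bound: "\<exists>a\<in>A. \<Union>\<F> \<subseteq> a" if "finite \<F>" "\<F> \<subseteq> A" for \<F>
    using that
  proof (induction \<F>)
    case empty
    show ?case using directed_in_opnD(2)[OF assms(2)] by auto
  next
    case (insert x \<F>)
    then obtain a where "a \<in> A" "\<Union>\<F> \<subseteq> a" by auto
    moreover from this obtain z where "z \<in> A" "x \<subseteq> z" "a \<subseteq> z"
      using directed_in_opnD(3)[OF assms(2), of x a] insert.prems by auto
    ultimately show ?case by (intro bexI[of _ z]) auto
  qed
  obtain \<F> where \<F>: "finite \<F>" "\<F> \<subseteq> A" "c \<subseteq> \<Union>\<F>"
    using assms(1,3) directed_in_opnD(1)[OF assms(2)] unfolding compactin_def by meson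
  show ?thesis using bound[OF \<F>(1,2)] order_trans[OF \<F>(3)] by auto
qed

text \<open>Supplies the directed joins to which \<open>M\<^sub>3\<close> and
  \<open>M\<^sub>6\<close> are applied.\<close>

lemma regular_space_directed_Union:
  assumes "regular_space X" "openin X a"
  defines "A \<equiv> {b. openin X b \<and> X closure_of b \<subseteq> a}"
  shows "directed_in (opn X) A" "\<Union>A = a"
proof -
  have "\<exists>b\<in>A. x \<in> b" if x: "x \<in> a" for x
  proof -
    \<comment> \<open>A closed neighbourhood of \<open>x\<close> inside \<open>a\<close> also
      contains the closure of its open part.\<close>
    have "neighbourhood_base_of (closedin X) X"
      using assms(1) by (simp add: neighbourhood_base_of_closedin)
    then obtain U V where "openin X U" "closedin X V" "x \<in> U" "U \<subseteq> V" "V \<subseteq> a"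
      using assms(2) x unfolding neighbourhood_base_of by meson
    then show ?thesis
      unfolding A_def using closure_of_minimal[of U V X] by blast
  qed
  moreover have "b \<subseteq> a" if "b \<in> A" for b
    using that closure_of_subset[OF openin_subset] unfolding A_def by blast
  ultimately show "\<Union>A = a" by blast
  \<comment> \<open>The empty set keeps the family nonempty even if \<open>a\<close> is empty;
    unions stay in it because closure commutes with finite unions.\<close>
  have "{} \<in> A" "\<And>x y. x \<in> A \<Longrightarrow> y \<in> A \<Longrightarrow> x \<union> y \<in> A"
    by (auto simp: A_def)
  then show "directed_in (opn X) A"
    unfolding directed_in_opn by (metis (no_types, lifting) A_def Un_upper1 Un_upper2 empty_iff mem_Collect_eq)
qed

section \<open>Points of \<open>D_kh X\<close> and compactness\<close>

text \<open>Upward closure holds because the closed set that witnesses \<open>u\<close> also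
  witnesses \<open>v\<close>. In the last rule \<open>c\<close> is its own witness.\<close>

lemma D_kh_pointsD:
  assumes "W \<in> D_kh_points X"
  shows "u \<in> W \<Longrightarrow> u \<subseteq> topspace X"
    "u \<in> W \<Longrightarrow> u \<subseteq> v \<Longrightarrow> v \<subseteq> topspace X \<Longrightarrow> v \<in> W"
    "u \<in> W \<Longrightarrow> \<exists>c. closedin X c \<and> c \<subseteq> u \<and> (\<forall>a. openin X a \<and> c \<subseteq> a \<longrightarrow> a \<in> W)"
    "closedin X c \<Longrightarrow> (\<And>a. openin X a \<Longrightarrow> c \<subseteq> a \<Longrightarrow> a \<in> W) \<Longrightarrow> c \<in> W"
proof -
  have sub: "W \<subseteq> Pow (topspace X)" and iff: "\<And>u. u \<subseteq> topspace X \<Longrightarrow> u \<in> W \<longleftrightarrow>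
      (\<exists>c. closedin X c \<and> c \<subseteq> u \<and> (\<forall>a. openin X a \<and> c \<subseteq> a \<longrightarrow> a \<in> W))"
    using assms unfolding D_kh_points_def by blast+
  show 1: "u \<subseteq> topspace X" if "u \<in> W" for u using that sub by blast
  show "\<exists>c. closedin X c \<and> c \<subseteq> u \<and> (\<forall>a. openin X a \<and> c \<subseteq> a \<longrightarrow> a \<in> W)" if "u \<in> W"
    using iff[of u] 1 that by blast
  show "v \<in> W" if "u \<in> W" "u \<subseteq> v" "v \<subseteq> topspace X"
    using iff[of u] iff[of v] that by (meson 1 order_trans)
  show "c \<in> W" if "closedin X c" "\<And>a. openin X a \<Longrightarrow> c \<subseteq> a \<Longrightarrow> a \<in> W"
    using iff[of c] that closedin_subset by blast
qed

text \<open>This becomes \<open>M\<^sub>3\<close>: the closed witness for the union is compact,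
  hence lies in a single member of \<open>A\<close>, which is then one of its open
  neighbourhoods.\<close>

lemma D_kh_points_Union_iff:
  assumes "compact_space X" "W \<in> D_kh_points X" "directed_in (opn X) A"
  shows "\<Union>A \<in> W \<longleftrightarrow> (\<exists>a\<in>A. a \<in> W)"
proof
  assume "\<Union>A \<in> W"
  then obtain c where c: "closedin X c" "c \<subseteq> \<Union>A" "\<forall>a. openin X a \<and> c \<subseteq> a \<longrightarrow> a \<in> W"
    using D_kh_pointsD(3)[OF assms(2)] by blast
  have "compactin X c" by (rule closedin_compact_space[OF assms(1) c(1)])
  with c assms(3) show "\<exists>a\<in>A. a \<in> W"
    using compactin_directed_Union[of X c A] directed_in_opnD(1)[OF assms(3)] by blast
next
  have "\<Union>A \<subseteq> topspace X" using openin_subset[OF directed_in_opnD(1)[OF assms(3)]] by blast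
  then show "\<exists>a\<in>A. a \<in> W \<Longrightarrow> \<Union>A \<in> W" using D_kh_pointsD(2)[OF assms(2)] by blast
qed

text \<open>In negated form this becomes \<open>M\<^sub>6\<close>.\<close>

lemma D_kh_points_Compl_Union_iff:
  assumes "compact_space X" "W \<in> D_kh_points X" "directed_in (opn X) A"
  shows "topspace X - \<Union>A \<in> W \<longleftrightarrow> (\<forall>a\<in>A. topspace X - a \<in> W)"
proof
  assume "topspace X - \<Union>A \<in> W"
  then show "\<forall>a\<in>A. topspace X - a \<in> W"
    using D_kh_pointsD(2)[OF assms(2)] by (meson Diff_mono Diff_subset Union_upper subset_refl)
next
  assume *: "\<forall>a\<in>A. topspace X - a \<in> W"
  have A: "openin X a" if "a \<in> A" for a using directed_in_opnD(1)[OF assms(3) that] .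
  show "topspace X - \<Union>A \<in> W"
  proof (rule D_kh_pointsD(4)[OF assms(2)])
    show "closedin X (topspace X - \<Union>A)" using A by blast
    fix u assume u: "openin X u" "topspace X - \<Union>A \<subseteq> u"
    \<comment> \<open>The complement of \<open>u\<close> is compact and covered by \<open>A\<close>,
      so some \<open>a\<close> in \<open>A\<close> contains it; then the complement of
      \<open>a\<close> lies in \<open>u\<close>, and upward closure applies.\<close>
    have "compactin X (topspace X - u)" using u(1) by (intro closedin_compact_space[OF assms(1)]) auto
    then obtain a where "a \<in> A" "topspace X - u \<subseteq> a"
      using compactin_directed_Union[OF _ assms(3)] u(2) by blast
    then show "u \<in> W"
      using * D_kh_pointsD(2)[OF assms(2), of "topspace X - a" u] openin_subset[OF u(1)] by blast
  qed
qed

section \<open>The homomorphism from \<open>M_frame (opn X)\<close> to the opens of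
  \<open>D_kh X\<close>\<close>

lemma openin_D_kh:
  assumes "openin X a"
  shows "openin (D_kh X) {W \<in> D_kh_points X. a \<in> W}"
    "openin (D_kh X) {W \<in> D_kh_points X. topspace X - a \<notin> W}"
  unfolding D_kh_def using assms by (auto intro!: topology_generated_by_Basis)

abbreviation M_gen :: "('a, 'c) gorder_scheme \<Rightarrow> 'a modal \<Rightarrow> 'a modal set set set"
  where "M_gen F \<equiv> presented_gen (M_gens F) (M_rels F)"

lemma frame_hom_M_frame_opn_D_kh:
  assumes "compact_space X"
  shows "\<exists>h. frame_hom (M_frame (opn X)) (opn (D_kh X)) h \<and>
    (\<forall>a. openin X a \<longrightarrow> h (M_gen (opn X) (Box a)) = {W \<in> D_kh_points X. a \<in> W} \<and>
      h (M_gen (opn X) (Dia a)) = {W \<in> D_kh_points X. topspace X - a \<notin> W})"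
proof -
  let ?K = "opn (D_kh X)" and ?G = "M_gens (opn X)"
  let ?b = "\<lambda>a. {W \<in> D_kh_points X. a \<in> W}" and ?d = "\<lambda>a. {W \<in> D_kh_points X. topspace X - a \<notin> W}"
  interpret K: frame ?K by (rule frame_opn)
  have gens: "g \<in> ?G \<longleftrightarrow> (\<exists>a. openin X a \<and> (g = Box a \<or> g = Dia a))" for g
    by (auto simp: M_gens_def opn_simps)
  have "(\<lambda>g. case g of Box a \<Rightarrow> ?b a | Dia a \<Rightarrow> ?d a) \<in> ?G \<rightarrow> carrier ?K"
    using openin_D_kh by (fastforce simp: gens opn_simps)
  from K.free_frame_hom_exists[OF this]
  obtain f where f: "frame_hom (free_frame ?G) ?K f"
    and "\<forall>g\<in>?G. f (free_gen ?G g) = (case g of Box a \<Rightarrow> ?b a | Dia a \<Rightarrow> ?d a)" by blast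
  then have fb: "f (free_gen ?G (Box a)) = ?b a" and fd: "f (free_gen ?G (Dia a)) = ?d a"
    if "openin X a" for a
    using that by (auto simp: gens)
  \<comment> \<open>The larger set is open for \<open>M\<^sub>1\<close> and
    \<open>M\<^sub>5\<close>, closed for \<open>M\<^sub>2\<close> and \<open>M\<^sub>4\<close>;
    these four relations all come down to upward closure.\<close>
  have up: "v \<in> W" if "W \<in> D_kh_points X" "u \<in> W" "u \<subseteq> v" "openin X v \<or> closedin X v" for W u v
    using D_kh_pointsD(2)[OF that(1-3)] that(4) openin_subset closedin_subset by blast
  have "\<forall>(u, v)\<in>M_rels (opn X). f u = f v"
  proof (subst M_rels_respected_iff[where \<beta> = ?b and \<delta> = ?d, OF frame_opn f _ _ frame_opn],
      goal_cases)
    \<comment> \<open>The first two goals only ask for the values of \<open>f\<close> on generators;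
      this one consists of the six identities.\<close>
    case 3
    have M1: "?b (a \<inter> b) \<inter> ?b a = ?b (a \<inter> b)" if "openin X a" "openin X b" for a b
      using up[of _ "a \<inter> b" a] that by auto
    have M2: "?b a \<inter> ?d b = {}" if "openin X a" "openin X b" "a \<inter> b = {}" for a b
      using up[of _ a "topspace X - b"] that openin_subset[of X a] by blast
    have M3: "?b (\<Union>A) = \<Union>(?b ` A)" if "directed_in (opn X) A" for A
      using D_kh_points_Union_iff[OF assms _ that] by blast
    have M4: "?d a \<inter> ?d (a \<union> b) = ?d a" if "openin X a" "openin X b" for a b
      using up[of _ "topspace X - (a \<union> b)" "topspace X - a"] that by auto
    have M5: "?b a \<union> ?d b = D_kh_points X" if "openin X a" "openin X b" "a \<union> b = topspace X" for a b
      using up[of _ "topspace X - b" a] that by blast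
    have M6: "?d (\<Union>A) = \<Union>(?d ` A)" if "directed_in (opn X) A" for A
      using D_kh_points_Compl_Union_iff[OF assms _ that] by blast
    have A: "openin X a" if "directed_in (opn X) A" "a \<in> A" for A a
      by (rule directed_in_opnD(1)[OF that])
    have s: "\<Squnion>\<^bsub>opn X\<^esub> A = \<Union>A" if "directed_in (opn X) A" for A
      by (rule opn_simps(4)[OF A[OF that]])
    have sb: "\<Squnion>\<^bsub>?K\<^esub> (?b ` A) = \<Union>(?b ` A)" if "directed_in (opn X) A" for A
      by (rule opn_simps(4)) (use A[OF that] openin_D_kh in blast)
    have sd: "\<Squnion>\<^bsub>?K\<^esub> (?d ` A) = \<Union>(?d ` A)" if "directed_in (opn X) A" for A
      by (rule opn_simps(4)) (use A[OF that] openin_D_kh in blast)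
    show ?case
    proof (intro conjI ballI allI impI, goal_cases)
      case (1 a b) then show ?case
        using M1[of a b] by (simp add: opn_simps openin_D_kh openin_Int)
    next
      case (2 a b) then show ?case
        using M2[of a b] by (simp add: opn_simps openin_D_kh)
    next
      case (3 A) then show ?case unfolding s[OF 3] sb[OF 3] by (rule M3)
    next
      case (4 a b) then show ?case
        using M4[of a b] by (simp add: opn_simps openin_D_kh openin_Un)
    next
      case (5 a b) then show ?case
        using M5[of a b] by (simp add: opn_simps openin_D_kh topspace_D_kh)
    next
      case (6 A) then show ?case unfolding s[OF 6] sd[OF 6] by (rule M6)
    qed
  qed (simp_all add: fb fd opn_simps)
  from presented_frame_universal[OF frame_opn M_rels_carrier f this]
  obtain h where "frame_hom (M_frame (opn X)) ?K h"
    "\<forall>g\<in>?G. h (M_gen (opn X) g) = f (free_gen ?G g)"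
    unfolding M_frame_def by blast
  then show ?thesis by (auto simp: gens fb fd)
qed

section \<open>Points of \<open>M_frame F\<close> through their values on generators\<close>

lemma frame_hom_free_M_frame:
  "frame_hom (free_frame (M_gens F)) (M_frame F)
    (\<lambda>u. generated_congruence (free_frame (M_gens F)) (M_rels F) `` {u})"
  unfolding M_frame_def presented_frame_def
  by (rule frame.frame_hom_quotient[OF frame_free_frame
        frame_congruence_generated(1)[OF frame_free_frame M_rels_carrier]])

text \<open>Composing \<open>p\<close> with the quotient map gives a homomorphism \<open>q\<close>
  on the free frame. It identifies related pairs, since they have the same class, and the resulting
  identities are then read off in \<open>two\<close>.\<close>

lemma points_M_frame_rels:
  assumes F: "frame F" and p: "p \<in> points (M_frame F)"
  defines "\<beta> \<equiv> \<lambda>a. p (M_gen F (Box a))" and "\<delta> \<equiv> \<lambda>a. p (M_gen F (Dia a))"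
  shows "\<lbrakk>a \<in> carrier F; b \<in> carrier F; \<beta> (a \<sqinter>\<^bsub>F\<^esub> b)\<rbrakk> \<Longrightarrow> \<beta> a"
    "\<lbrakk>a \<in> carrier F; b \<in> carrier F; a \<sqinter>\<^bsub>F\<^esub> b = \<bottom>\<^bsub>F\<^esub>; \<beta> a; \<delta> b\<rbrakk> \<Longrightarrow> False"
    "directed_in F A \<Longrightarrow> \<beta> (\<Squnion>\<^bsub>F\<^esub> A) \<longleftrightarrow> (\<exists>a\<in>A. \<beta> a)"
    "\<lbrakk>a \<in> carrier F; b \<in> carrier F; \<delta> a\<rbrakk> \<Longrightarrow> \<delta> (a \<squnion>\<^bsub>F\<^esub> b)"
    "\<lbrakk>a \<in> carrier F; b \<in> carrier F; a \<squnion>\<^bsub>F\<^esub> b = \<top>\<^bsub>F\<^esub>\<rbrakk> \<Longrightarrow> \<beta> a \<or> \<delta> b"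
    "directed_in F A \<Longrightarrow> \<delta> (\<Squnion>\<^bsub>F\<^esub> A) \<longleftrightarrow> (\<exists>a\<in>A. \<delta> a)"
proof -
  let ?\<theta> = "generated_congruence (free_frame (M_gens F)) (M_rels F)"
  define q where "q u = p (?\<theta> `` {u})" for u
  interpret two: frame two by (rule frame_two)
  have bot: "\<bottom>\<^bsub>two\<^esub> = False" using two.sup_empty_eq_bottom by (simp add: two_simps)
  have q: "frame_hom (free_frame (M_gens F)) two q"
    unfolding q_def
    by (rule frame_hom_comp[OF frame_hom_free_M_frame]) (use p in \<open>simp add: points_def\<close>)
  have "q u = q v" if "(u, v) \<in> M_rels F" for u v
  proof -
    have "(u, v) \<in> ?\<theta>"
      using frame_congruence_generated(2)[OF frame_free_frame M_rels_carrier] that by blast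
    moreover have "equiv (carrier (free_frame (M_gens F))) ?\<theta>"
      using frame_congruence_generated(1)[OF frame_free_frame M_rels_carrier]
      unfolding frame_congruence_def by blast
    ultimately have "?\<theta> `` {u} = ?\<theta> `` {v}" by (metis equiv_class_eq)
    then show ?thesis by (simp add: q_def)
  qed
  then have "\<forall>(u, v)\<in>M_rels F. q u = q v" by blast
  then have *: "(\<forall>a\<in>carrier F. \<forall>b\<in>carrier F. \<beta> (a \<sqinter>\<^bsub>F\<^esub> b) \<sqinter>\<^bsub>two\<^esub> \<beta> a = \<beta> (a \<sqinter>\<^bsub>F\<^esub> b)) \<and>
    (\<forall>a\<in>carrier F. \<forall>b\<in>carrier F. a \<sqinter>\<^bsub>F\<^esub> b = \<bottom>\<^bsub>F\<^esub> \<longrightarrow> \<beta> a \<sqinter>\<^bsub>two\<^esub> \<delta> b = \<bottom>\<^bsub>two\<^esub>) \<and>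
    (\<forall>A. directed_in F A \<longrightarrow> \<beta> (\<Squnion>\<^bsub>F\<^esub> A) = \<Squnion>\<^bsub>two\<^esub> (\<beta> ` A)) \<and>
    (\<forall>a\<in>carrier F. \<forall>b\<in>carrier F. \<delta> a \<sqinter>\<^bsub>two\<^esub> \<delta> (a \<squnion>\<^bsub>F\<^esub> b) = \<delta> a) \<and>
    (\<forall>a\<in>carrier F. \<forall>b\<in>carrier F. a \<squnion>\<^bsub>F\<^esub> b = \<top>\<^bsub>F\<^esub> \<longrightarrow> \<beta> a \<squnion>\<^bsub>two\<^esub> \<delta> b = \<top>\<^bsub>two\<^esub>) \<and>
    (\<forall>A. directed_in F A \<longrightarrow> \<delta> (\<Squnion>\<^bsub>F\<^esub> A) = \<Squnion>\<^bsub>two\<^esub> (\<delta> ` A))"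
    by (subst (asm) M_rels_respected_iff[where \<beta> = \<beta> and \<delta> = \<delta>, OF frame_two q _ _ F])
      (simp_all add: \<beta>_def \<delta>_def q_def presented_gen_def)
  have join: "a \<squnion>\<^bsub>two\<^esub> b = (a \<or> b)" for a b by (simp add: join_def two_simps)
  note ** = *[THEN conjunct1] *[THEN conjunct2, THEN conjunct1]
    *[THEN conjunct2, THEN conjunct2, THEN conjunct1]
    *[THEN conjunct2, THEN conjunct2, THEN conjunct2, THEN conjunct1]
    *[THEN conjunct2, THEN conjunct2, THEN conjunct2, THEN conjunct2, THEN conjunct1]
    *[THEN conjunct2, THEN conjunct2, THEN conjunct2, THEN conjunct2, THEN conjunct2]
  show "\<lbrakk>a \<in> carrier F; b \<in> carrier F; \<beta> (a \<sqinter>\<^bsub>F\<^esub> b)\<rbrakk> \<Longrightarrow> \<beta> a"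
    using **(1) unfolding two_simps by blast
  show "\<lbrakk>a \<in> carrier F; b \<in> carrier F; a \<sqinter>\<^bsub>F\<^esub> b = \<bottom>\<^bsub>F\<^esub>; \<beta> a; \<delta> b\<rbrakk> \<Longrightarrow> False"
    using **(2) by (simp add: two_simps bot)
  show "directed_in F A \<Longrightarrow> \<beta> (\<Squnion>\<^bsub>F\<^esub> A) \<longleftrightarrow> (\<exists>a\<in>A. \<beta> a)"
    using **(3) by (auto simp: two_simps)
  show "\<lbrakk>a \<in> carrier F; b \<in> carrier F; \<delta> a\<rbrakk> \<Longrightarrow> \<delta> (a \<squnion>\<^bsub>F\<^esub> b)"
    using **(4) unfolding two_simps by blast
  show "\<lbrakk>a \<in> carrier F; b \<in> carrier F; a \<squnion>\<^bsub>F\<^esub> b = \<top>\<^bsub>F\<^esub>\<rbrakk> \<Longrightarrow> \<beta> a \<or> \<delta> b"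
    using **(5) by (simp add: two_simps join)
  show "directed_in F A \<Longrightarrow> \<delta> (\<Squnion>\<^bsub>F\<^esub> A) \<longleftrightarrow> (\<exists>a\<in>A. \<delta> a)"
    using **(6) by (auto simp: two_simps)
qed

text \<open>The quotient map is onto, so it suffices to compare the two composites with it; these
  are homomorphisms on a free frame and agree on its generators.\<close>

lemma points_M_frame_eqI:
  assumes p: "p \<in> points (M_frame F)" and q: "q \<in> points (M_frame F)"
    and eq: "\<And>a. a \<in> carrier F \<Longrightarrow> p (M_gen F (Box a)) = q (M_gen F (Box a))"
      "\<And>a. a \<in> carrier F \<Longrightarrow> p (M_gen F (Dia a)) = q (M_gen F (Dia a))"
  shows "p = q"
proof (rule extensionalityI)
  let ?G = "M_gens F"
  let ?\<theta> = "generated_congruence (free_frame ?G) (M_rels F)"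
  show "p \<in> extensional (carrier (M_frame F))" "q \<in> extensional (carrier (M_frame F))"
    using p q by (auto simp: points_def)
  fix m assume "m \<in> carrier (M_frame F)"
  then obtain u where u: "u \<in> carrier (free_frame ?G)" "m = ?\<theta> `` {u}"
    by (auto simp: M_frame_def presented_frame_def quotient_frame_def quotient_def)
  have hom: "frame_hom (free_frame ?G) two (\<lambda>u. r (?\<theta> `` {u}))" if "r \<in> points (M_frame F)" for r
    by (rule frame_hom_comp[OF frame_hom_free_M_frame]) (use that in \<open>simp add: points_def\<close>)
  show "p m = q m"
    unfolding u(2)
    by (rule free_frame_hom_unique[OF hom[OF p] hom[OF q] _ u(1)])
      (use eq in \<open>auto simp: M_gens_def presented_gen_def\<close>)
qed

lemma M_gen_carrier: "M_gen F g \<in> carrier (M_frame F)"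
  using frame_homD(1)[OF frame_hom_free_M_frame free_gen_carrier]
  by (simp add: presented_gen_def)

section \<open>From points of \<open>M_frame (opn X)\<close> to points of
  \<open>D_kh X\<close>\<close>

definition D_kh_of_point :: "'a topology \<Rightarrow> ('a set modal set set set \<Rightarrow> bool) \<Rightarrow> 'a set set"
  where "D_kh_of_point X p = {u. u \<subseteq> topspace X \<and>
    (\<exists>c. closedin X c \<and> c \<subseteq> u \<and> (\<forall>a. openin X a \<and> c \<subseteq> a \<longrightarrow> p (M_gen (opn X) (Box a))))}"

context
  fixes X :: "'a topology" and p
  assumes reg: "regular_space X" and p: "p \<in> points (M_frame (opn X))"
begin

lemma point_Box_mono:
  assumes "openin X a" "openin X b" "a \<subseteq> b" "p (M_gen (opn X) (Box a))"
  shows "p (M_gen (opn X) (Box b))"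
  using points_M_frame_rels(1)[OF frame_opn p, of b a] assms
  by (simp add: opn_simps Int_absorb1)

lemma open_in_D_kh_of_point_iff:
  assumes a: "openin X a"
  shows "a \<in> D_kh_of_point X p \<longleftrightarrow> p (M_gen (opn X) (Box a))"
proof
  show "p (M_gen (opn X) (Box a))" if "a \<in> D_kh_of_point X p"
    using that a unfolding D_kh_of_point_def by blast
  assume *: "p (M_gen (opn X) (Box a))"
  let ?A = "{b. openin X b \<and> X closure_of b \<subseteq> a}"
  note A = regular_space_directed_Union[OF reg a]
  have "\<Squnion>\<^bsub>opn X\<^esub> ?A = a" using A(2) by (subst opn_simps(4)) auto
  then obtain b where b: "openin X b" "X closure_of b \<subseteq> a" "p (M_gen (opn X) (Box b))"
    using points_M_frame_rels(3)[OF frame_opn p A(1)] * by auto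
  have "b \<subseteq> X closure_of b" using b(1) by (simp add: closure_of_subset openin_subset)
  \<comment> \<open>The closure of \<open>b\<close> is the closed witness for \<open>a\<close>: its
    open neighbourhoods contain \<open>b\<close>.\<close>
  then have "\<forall>d. openin X d \<and> X closure_of b \<subseteq> d \<longrightarrow> p (M_gen (opn X) (Box d))"
    using point_Box_mono b(1,3) by blast
  then show "a \<in> D_kh_of_point X p"
    unfolding D_kh_of_point_def using b(2) openin_subset[OF a] closedin_closure_of[of X b] by blast
qed

lemma Compl_in_D_kh_of_point_iff:
  assumes a: "openin X a"
  shows "topspace X - a \<in> D_kh_of_point X p \<longleftrightarrow> \<not> p (M_gen (opn X) (Dia a))"
proof
  assume "topspace X - a \<in> D_kh_of_point X p"
  then obtain c where c: "closedin X c" "c \<subseteq> topspace X - a"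
    "\<forall>a. openin X a \<and> c \<subseteq> a \<longrightarrow> p (M_gen (opn X) (Box a))"
    unfolding D_kh_of_point_def by blast
  show "\<not> p (M_gen (opn X) (Dia a))"
  proof
    assume *: "p (M_gen (opn X) (Dia a))"
    let ?A = "{b. openin X b \<and> X closure_of b \<subseteq> a}"
    note A = regular_space_directed_Union[OF reg a]
    have "\<Squnion>\<^bsub>opn X\<^esub> ?A = a" using A(2) by (subst opn_simps(4)) auto
    then obtain b where b: "openin X b" "X closure_of b \<subseteq> a" "p (M_gen (opn X) (Dia b))"
      using points_M_frame_rels(6)[OF frame_opn p A(1)] * by auto
    \<comment> \<open>This open set contains \<open>c\<close>, so its \<open>Box\<close> holds at
      \<open>p\<close>. It is disjoint from \<open>b\<close>, whose \<open>Dia\<close> holds too,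
      against \<open>M\<^sub>2\<close>.\<close>
    have d: "openin X (topspace X - X closure_of b)" by (simp add: openin_diff)
    have "(topspace X - X closure_of b) \<inter> b = {}"
      using b(1) closure_of_subset[OF openin_subset] by blast
    moreover have "p (M_gen (opn X) (Box (topspace X - X closure_of b)))"
      using c(2,3) b(2) d by blast
    ultimately show False
      using points_M_frame_rels(2)[OF frame_opn p, of "topspace X - X closure_of b" b] b d
      by (simp add: opn_simps)
  qed
next
  assume *: "\<not> p (M_gen (opn X) (Dia a))"
  \<comment> \<open>By \<open>M\<^sub>5\<close>, every open neighbourhood of the complement of
    \<open>a\<close> has its \<open>Box\<close> true, so that complement is its own closed
    witness.\<close>
  have "p (M_gen (opn X) (Box b))" if "openin X b" "topspace X - a \<subseteq> b" for b
  proof -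
    have "b \<union> a = topspace X" using that a openin_subset by blast
    then show ?thesis
      using points_M_frame_rels(5)[OF frame_opn p, of b a] that a * by (simp add: opn_simps)
  qed
  moreover have "closedin X (topspace X - a)" using a by blast
  ultimately show "topspace X - a \<in> D_kh_of_point X p"
    unfolding D_kh_of_point_def by blast
qed

text \<open>For open \<open>a\<close>, being a member is the same as \<open>p\<close> holding at
  \<open>Box a\<close>, so the defining condition of \<open>D_kh_points\<close> is the definition of
  \<open>D_kh_of_point\<close> itself.\<close>

lemma D_kh_of_point_in_D_kh_points: "D_kh_of_point X p \<in> D_kh_points X"
  unfolding D_kh_points_def
proof (intro CollectI conjI allI impI)
  show "D_kh_of_point X p \<subseteq> Pow (topspace X)" by (auto simp: D_kh_of_point_def)
  fix u assume "u \<subseteq> topspace X"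
  then show "u \<in> D_kh_of_point X p \<longleftrightarrow>
      (\<exists>c. closedin X c \<and> c \<subseteq> u \<and> (\<forall>a. openin X a \<and> c \<subseteq> a \<longrightarrow> a \<in> D_kh_of_point X p))"
    using open_in_D_kh_of_point_iff by (subst D_kh_of_point_def) auto
qed

end

section \<open>The homeomorphism\<close>

text \<open>The open members determine the closed ones, and these determine all members by upward
  closure, since each member contains a closed one.\<close>

lemma D_kh_points_eqI:
  assumes V: "V \<in> D_kh_points X" and W: "W \<in> D_kh_points X"
    and eq: "\<And>a. openin X a \<Longrightarrow> a \<in> V \<longleftrightarrow> a \<in> W"
  shows "V = W"
proof -
  have sub: "V' \<subseteq> W'" if V': "V' \<in> D_kh_points X" and W': "W' \<in> D_kh_points X"
    and le: "\<And>a. openin X a \<Longrightarrow> a \<in> V' \<Longrightarrow> a \<in> W'" for V' W'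
  proof
    fix u assume u: "u \<in> V'"
    obtain c where c: "closedin X c" "c \<subseteq> u" "\<forall>a. openin X a \<and> c \<subseteq> a \<longrightarrow> a \<in> V'"
      using D_kh_pointsD(3)[OF V' u] by blast
    have "c \<in> W'" by (rule D_kh_pointsD(4)[OF W' c(1)]) (use c(3) le in blast)
    then show "u \<in> W'" by (rule D_kh_pointsD(2)[OF W' _ c(2) D_kh_pointsD(1)[OF V' u]])
  qed
  show ?thesis using sub[OF V W] sub[OF W V] eq by blast
qed

theorem theorem4p9:
  fixes X :: "'a topology"
  assumes "compact_space X" and "Hausdorff_space X"
  shows "pt (M_frame (opn X)) homeomorphic_space D_kh X"
proof -
  let ?M = "M_frame (opn X)"
  have reg: "regular_space X" using assms by (simp add: compact_Hausdorff_imp_regular_space)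
  note ts = topspace_pt[OF frame_M_frame] topspace_D_kh
  obtain h where h: "frame_hom ?M (opn (D_kh X)) h"
    and gens: "\<forall>a. openin X a \<longrightarrow> h (M_gen (opn X) (Box a)) = {W \<in> D_kh_points X. a \<in> W} \<and>
      h (M_gen (opn X) (Dia a)) = {W \<in> D_kh_points X. topspace X - a \<notin> W}"
    using frame_hom_M_frame_opn_D_kh[OF assms(1)] by (elim exE conjE)
  have hb: "h (M_gen (opn X) (Box a)) = {W \<in> D_kh_points X. a \<in> W}"
    and hd: "h (M_gen (opn X) (Dia a)) = {W \<in> D_kh_points X. topspace X - a \<notin> W}"
    if "openin X a" for a
    using gens that by simp_all
  have ho: "openin (D_kh X) (h m)" if "m \<in> carrier ?M" for m
    using frame_homD(1)[OF h that] by (simp add: opn_simps)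
  \<comment> \<open>The restriction meets the extensionality demanded in
    \<open>points\<close>.\<close>
  define g where "g W = restrict (\<lambda>m. W \<in> h m) (carrier ?M)" for W
  interpret M: frame ?M by (rule frame_M_frame)
  \<comment> \<open>Testing whether \<open>W\<close> lies in an open set is a frame homomorphism
    from the opens of \<open>D_kh X\<close> to \<open>two\<close>, as finite meets are intersections
    and joins are unions; on the carrier \<open>g W\<close> is its composite with
    \<open>h\<close>.\<close>
  have gp: "g W \<in> points ?M" if W: "W \<in> D_kh_points X" for W
    unfolding points_def
  proof (intro CollectI conjI frame_homI)
    show "g W \<in> extensional (carrier ?M)" by (simp add: g_def)
    show "g W \<top>\<^bsub>?M\<^esub> = \<top>\<^bsub>two\<^esub>"
      using frame_homD(2)[OF h] W by (simp add: g_def two_simps opn_simps topspace_D_kh)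
    show "g W (a \<sqinter>\<^bsub>?M\<^esub> b) = g W a \<sqinter>\<^bsub>two\<^esub> g W b" if "a \<in> carrier ?M" "b \<in> carrier ?M" for a b
      using frame_homD(3)[OF h that] ho that by (simp add: g_def two_simps opn_simps)
    show "g W (\<Squnion>\<^bsub>?M\<^esub> S) = \<Squnion>\<^bsub>two\<^esub> (g W ` S)" if S: "S \<subseteq> carrier ?M" for S
    proof -
      have "h (\<Squnion>\<^bsub>?M\<^esub> S) = \<Union>(h ` S)"
        unfolding frame_homD(4)[OF h S] by (rule opn_simps(4)) (use S ho in auto)
      moreover have "g W ` S = (\<lambda>m. W \<in> h m) ` S"
        unfolding g_def by (rule image_cong) (use S in auto)
      ultimately show ?thesis using M.sup_closed[OF S] by (auto simp: g_def two_simps)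
    qed
  qed (simp add: two_simps)
  have gb: "g W (M_gen (opn X) (Box a)) \<longleftrightarrow> a \<in> W"
    and gd: "g W (M_gen (opn X) (Dia a)) \<longleftrightarrow> topspace X - a \<notin> W"
    if "W \<in> D_kh_points X" "openin X a" for W a
    using that by (simp_all add: g_def M_gen_carrier hb hd)
  note fW = D_kh_of_point_in_D_kh_points[OF reg]
  have op: "openin (pt ?M) {p \<in> points ?M. p m}" if "m \<in> carrier ?M" for m
    unfolding openin_pt[OF frame_M_frame] by (rule bexI[OF refl that])
  \<comment> \<open>Continuity is tested on the subbase, where the preimages are the basic open sets
    of the generators \<open>Box a\<close> and \<open>Dia a\<close>.\<close>
  have "continuous_map (pt ?M) (D_kh X) (D_kh_of_point X)"
    unfolding D_kh_def
  proof (rule continuous_on_generated_topo)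
    show "D_kh_of_point X ` topspace (pt ?M) \<subseteq> \<Union>({{W \<in> D_kh_points X. a \<in> W} |a. openin X a} \<union>
        {{W \<in> D_kh_points X. topspace X - a \<notin> W} |a. openin X a})"
      using fW unfolding topology_generated_by_topspace[symmetric] D_kh_def[symmetric] ts by blast
    fix U assume "U \<in> {{W \<in> D_kh_points X. a \<in> W} |a. openin X a} \<union>
        {{W \<in> D_kh_points X. topspace X - a \<notin> W} |a. openin X a}"
    then consider a where "openin X a" "U = {W \<in> D_kh_points X. a \<in> W}"
      | a where "openin X a" "U = {W \<in> D_kh_points X. topspace X - a \<notin> W}" by blast
    then show "openin (pt ?M) (D_kh_of_point X -` U \<inter> topspace (pt ?M))"
    proof cases
      case 1
      then have "D_kh_of_point X -` U \<inter> topspace (pt ?M) = {p \<in> points ?M. p (M_gen (opn X) (Box a))}"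
        using fW open_in_D_kh_of_point_iff[OF reg] by (auto simp: ts)
      then show ?thesis using op[OF M_gen_carrier] by simp
    next
      case 2
      then have "D_kh_of_point X -` U \<inter> topspace (pt ?M) = {p \<in> points ?M. p (M_gen (opn X) (Dia a))}"
        using fW Compl_in_D_kh_of_point_iff[OF reg] by (auto simp: ts)
      then show ?thesis using op[OF M_gen_carrier] by simp
    qed
  qed
  moreover have "continuous_map (D_kh X) (pt ?M) g"
    unfolding continuous_map
  proof (intro conjI allI impI)
    show "g ` topspace (D_kh X) \<subseteq> topspace (pt ?M)" using gp by (auto simp: ts)
    fix U assume "openin (pt ?M) U"
    then obtain m where m: "m \<in> carrier ?M" "U = {p \<in> points ?M. p m}"
      unfolding openin_pt[OF frame_M_frame] by (elim bexE)
    have "{W \<in> topspace (D_kh X). g W \<in> U} = h m"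
      using gp m openin_subset[OF ho[OF m(1)]] by (auto simp: ts g_def)
    then show "openin (D_kh X) {W \<in> topspace (D_kh X). g W \<in> U}" using ho[OF m(1)] by simp
  qed
  \<comment> \<open>The two composites are compared on generators here and on open sets
    below.\<close>
  moreover have "g (D_kh_of_point X p) = p" if "p \<in> points ?M" for p
    by (rule points_M_frame_eqI[OF gp[OF fW[OF that]] that])
      (simp_all add: opn_simps gb[OF fW[OF that]] gd[OF fW[OF that]] open_in_D_kh_of_point_iff[OF reg that]
        Compl_in_D_kh_of_point_iff[OF reg that])
  moreover have "D_kh_of_point X (g W) = W" if "W \<in> D_kh_points X" for W
    by (rule D_kh_points_eqI[OF fW[OF gp[OF that]] that])
      (simp add: gb[OF that] open_in_D_kh_of_point_iff[OF reg gp[OF that]])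
  ultimately have "homeomorphic_maps (pt ?M) (D_kh X) (D_kh_of_point X) g"
    unfolding homeomorphic_maps_def ts by simp
  then show ?thesis unfolding homeomorphic_space_def by (intro exI)
qed

end
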